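(* Let $\alpha>0$ and $p\in[0,1]$, and let $\mathcal{C}_n$ be the root cluster of the random preferential attachment tree $\mathcal{T}_n=\mathcal{T}_{\alpha,n}$ with broadcasting induced colouring with parameter $p$. Then, as $n\to\infty$, $$\frac{|\mathcal{C}_n|}{n^{(p+\alpha)/(1+\alpha)}}\xrightarrow{d}\mathcal{C},$$ where $\mathcal{C}$ is a random variable with integer moments, for all integers $k\ge1$, $$\mathbb{E}[\mathcal{C}^k]=\frac{C_k(1+\alpha)\Gamma(1/(1+\alpha))}{\alpha\,\Gamma((kp+\alpha(k-1))/(\alpha+1))},$$ where $C_k$ satisfies the recursion $C_1=\alpha/(p+\alpha)$ and, for $k\ge2$, $$(k-1)(p/\alpha+1)C_k=\sum_{j=2}^k\frac{p^j\,\Gamma(1/\alpha+j)}{\Gamma(1/\alpha)}B_{k,j}(C_1,\ldots,C_{k-j+1}).$$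
   Context: The random (linear) preferential attachment trees $(\mathcal{T}_n)_{n\ge1}=(\mathcal{T}_{\alpha,n})_{n\ge1}$ are rooted trees grown recursively: $\mathcal{T}_1$ is a single vertex $\rho$, the root of all the trees; $\mathcal{T}_n$ is obtained from $\mathcal{T}_{n-1}$ by choosing a vertex $v$ of $\mathcal{T}_{n-1}$ at random with probability $\frac{\alpha\deg^+(v)+1}{\sum_{u\in V(\mathcal{T}_{n-1})}(\alpha\deg^+(u)+1)}$ and adding a new child to $v$, where $\deg^+(u)$ is the number of children of $u$ in $\mathcal{T}_{n-1}$. The broadcasting induced colouring of $\mathcal{T}_n$ with parameter $p$: the root is red or blue with probability $1/2$ each, and every other vertex, when added, receives the colour of its parent with probability $p$ and the other colour with probability $1-p$, independently of everything else. The root cluster $\mathcal{C}_n$ is the maximal monochromatic (connected) subtree of $\mathcal{T}_n$ containing the root, and $|\mathcal{C}_n|$ is its number of vertices. The partial Bell polynomials are $$B_{k,j}(x_1,\ldots,x_{k-j+1})=\sum_{\substack{m_1+2m_2+\cdots+(k-j+1)m_{k-j+1}=k\\ m_1+\cdots+m_{k-j+1}=j}}k!\prod_{i=1}^{k-j+1}\frac{x_i^{m_i}}{m_i!\,(i!)^{m_i}},$$ the sum being over nonnegative integers $m_i$. Convention: $1/\Gamma(0)=0$ (only relevant for $p=0$, $k=1$). *)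

theory Defs
  imports "HOL-Probability.Probability" "Graph_Theory.Digraph_Component"
begin

text \<open>
  Trees are directed graphs with an arc from each vertex to each of its children, so that
  the number of children of a vertex is its out-degree. The root is \<open>0\<close>, and the other
  vertices are numbered in the order in which they are added.
\<close>

abbreviation root_vertex :: nat where
  "root_vertex \<equiv> 0"

definition single_vertex :: "nat pair_pre_digraph" where
  "single_vertex = \<lparr> pverts = {root_vertex}, parcs = {} \<rparr>"

definition new_vertex :: "nat pair_pre_digraph \<Rightarrow> nat" where
  "new_vertex T = card (pverts T)"

definition add_child :: "nat pair_pre_digraph \<Rightarrow> nat \<Rightarrow> nat pair_pre_digraph" where
  "add_child T v =
     \<lparr> pverts = insert (new_vertex T) (pverts T), parcs = insert (v, new_vertex T) (parcs T) \<rparr>"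

definition attach_weight :: "real \<Rightarrow> nat pair_pre_digraph \<Rightarrow> nat \<Rightarrow> real" where
  "attach_weight \<alpha> T v = \<alpha> * real (out_degree (with_proj T) v) + 1"

definition attach_pmf :: "real \<Rightarrow> nat pair_pre_digraph \<Rightarrow> nat pmf" where
  "attach_pmf \<alpha> T = embed_pmf (\<lambda>v.
     if v \<in> pverts T then attach_weight \<alpha> T v / (\<Sum>u\<in>pverts T. attach_weight \<alpha> T u) else 0)"

text \<open>The weights do define a probability mass function on every nonempty finite tree.\<close>

lemma pmf_attach_pmf:
  assumes "\<alpha> \<ge> 0" "finite (pverts T)" "pverts T \<noteq> {}"
  shows "pmf (attach_pmf \<alpha> T) v =
    (if v \<in> pverts T then attach_weight \<alpha> T v / (\<Sum>u\<in>pverts T. attach_weight \<alpha> T u) else 0)"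
proof -
  let ?S = "\<Sum>u\<in>pverts T. attach_weight \<alpha> T u"
  let ?f = "\<lambda>v. if v \<in> pverts T then attach_weight \<alpha> T v / ?S else 0"
  have pos: "attach_weight \<alpha> T u > 0" for u
    using assms(1) by (simp add: attach_weight_def add_nonneg_pos)
  have S: "?S > 0"
    using assms pos by (intro sum_pos) auto
  have nonneg: "?f v \<ge> 0" for v
    using pos[of v] S by simp
  have "(\<integral>\<^sup>+v. ennreal (?f v) \<partial>count_space UNIV) = (\<Sum>v\<in>pverts T. ennreal (?f v))"
    using assms(2) by (intro nn_integral_count_space') auto
  also have "\<dots> = ennreal (\<Sum>v\<in>pverts T. ?f v)"
    using nonneg by (intro sum_ennreal) blast
  also have "(\<Sum>v\<in>pverts T. ?f v) = (\<Sum>v\<in>pverts T. attach_weight \<alpha> T v / ?S)"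
    by (intro sum.cong) auto
  also have "\<dots> = 1"
    using S by (simp flip: sum_divide_distrib)
  finally show ?thesis
    unfolding attach_pmf_def by (intro pmf_embed_pmf) (use nonneg in auto)
qed

text \<open>
  A coloured tree is a tree together with a colour (red is \<open>True\<close>, blue is \<open>False\<close>) for each
  vertex; the values of the colouring at numbers that are not vertices play no role.
\<close>

type_synonym coloured_tree = "nat pair_pre_digraph \<times> (nat \<Rightarrow> bool)"

definition coloured_tree_step :: "real \<Rightarrow> real \<Rightarrow> coloured_tree \<Rightarrow> coloured_tree pmf" where
  "coloured_tree_step \<alpha> p = (\<lambda>(T, c). do {
     v \<leftarrow> attach_pmf \<alpha> T;
     same \<leftarrow> bernoulli_pmf p;
     return_pmf (add_child T v, c(new_vertex T := (if same then c v else \<not> c v)))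
   })"

text \<open>
  The joint law of the tree with \<open>n\<close> vertices and of its colouring, for \<open>n \<ge> 1\<close>. The value at
  \<open>n = 0\<close> is irrelevant.
\<close>

primrec coloured_tree_pmf :: "real \<Rightarrow> real \<Rightarrow> nat \<Rightarrow> coloured_tree pmf" where
  "coloured_tree_pmf \<alpha> p 0 = map_pmf (\<lambda>b. (single_vertex, \<lambda>_. b)) (bernoulli_pmf (1/2))"
| "coloured_tree_pmf \<alpha> p (Suc n) =
     (if n = 0 then map_pmf (\<lambda>b. (single_vertex, \<lambda>_. b)) (bernoulli_pmf (1/2))
      else coloured_tree_pmf \<alpha> p n \<bind> coloured_tree_step \<alpha> p)"

text \<open>
  A subtree of a tree is determined by its vertex set, so the root cluster is represented by
  its set of vertices. Connectedness of a directed graph is that of the underlying undirected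
  graph.
\<close>

definition mono_root_subtree :: "nat pair_pre_digraph \<Rightarrow> (nat \<Rightarrow> bool) \<Rightarrow> nat set \<Rightarrow> bool" where
  "mono_root_subtree T c S \<longleftrightarrow>
     root_vertex \<in> S \<and> S \<subseteq> pverts T \<and> (\<forall>u\<in>S. \<forall>v\<in>S. c u = c v) \<and>
     Digraph_Component.connected (with_proj T \<restriction> S)"

definition root_cluster :: "nat pair_pre_digraph \<Rightarrow> (nat \<Rightarrow> bool) \<Rightarrow> nat set" where
  "root_cluster T c = \<Union> {S. mono_root_subtree T c S}"

text \<open>The union is itself a monochromatic subtree, hence the unique maximal one.\<close>

lemma root_cluster_greatest:
  assumes "root_vertex \<in> pverts T"
  shows "mono_root_subtree T c (root_cluster T c)"
    and "mono_root_subtree T c S \<Longrightarrow> S \<subseteq> root_cluster T c"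
    and "mono_root_subtree T c S \<Longrightarrow> (\<And>S'. mono_root_subtree T c S' \<Longrightarrow> S \<subseteq> S' \<Longrightarrow> S' = S)
           \<Longrightarrow> S = root_cluster T c"
proof -
  let ?R = "root_cluster T c"
  let ?sym = "\<lambda>S. with_proj (mk_symmetric (with_proj T \<restriction> S))"
  show upper: "S \<subseteq> ?R" if "mono_root_subtree T c S" for S
    using that by (auto simp: root_cluster_def)
  have "mono_root_subtree T c {root_vertex}"
    using assms by (auto simp: mono_root_subtree_def Digraph_Component.connected_def strongly_connected_def
      mk_symmetric_def reachable_def)
  then have root: "root_vertex \<in> ?R"
    using upper by blast
  have reach: "u \<rightarrow>\<^sup>*\<^bsub>?sym ?R\<^esub> v" if "mono_root_subtree T c S" "u \<in> S" "v \<in> S" for u v S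
  proof -
    have "u \<rightarrow>\<^sup>*\<^bsub>?sym S\<^esub> v"
      using that by (auto simp: mono_root_subtree_def Digraph_Component.connected_def strongly_connected_def
        mk_symmetric_def)
    then show ?thesis
      unfolding reachable_def using upper[OF that(1)]
      by (rule_tac rtrancl_on_mono[rotated 2])
        (auto simp: mk_symmetric_def arcs_ends_def arc_to_ends_def)
  qed
  have conn: "Digraph_Component.connected (with_proj T \<restriction> ?R)"
    unfolding Digraph_Component.connected_def strongly_connected_def
  proof (intro conjI ballI)
    show "verts (?sym ?R) \<noteq> {}"
      using root by (auto simp: mk_symmetric_def)
    fix u v assume "u \<in> verts (?sym ?R)" "v \<in> verts (?sym ?R)"
    then have "u \<in> ?R" "v \<in> ?R"
      by (auto simp: mk_symmetric_def)
    then obtain S S' where S: "mono_root_subtree T c S" "u \<in> S"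
      and S': "mono_root_subtree T c S'" "v \<in> S'"
      by (auto simp: root_cluster_def)
    have "root_vertex \<in> S" "root_vertex \<in> S'"
      using S S' by (simp_all add: mono_root_subtree_def)
    then have "u \<rightarrow>\<^sup>*\<^bsub>?sym ?R\<^esub> root_vertex" "root_vertex \<rightarrow>\<^sup>*\<^bsub>?sym ?R\<^esub> v"
      using reach[OF S] reach[OF S'(1) _ S'(2)] by simp_all
    then show "u \<rightarrow>\<^sup>*\<^bsub>?sym ?R\<^esub> v"
      unfolding reachable_def by (rule rtrancl_on_trans)
  qed
  have "c u = c root_vertex" if "u \<in> ?R" for u
    using that by (auto simp: root_cluster_def mono_root_subtree_def)
  then show cluster: "mono_root_subtree T c ?R"
    using root conn by (auto simp: root_cluster_def mono_root_subtree_def)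
  show "S = ?R" if "mono_root_subtree T c S"
    "\<And>S'. mono_root_subtree T c S' \<Longrightarrow> S \<subseteq> S' \<Longrightarrow> S' = S"
    using that upper cluster by blast
qed

text \<open>Partial Bell polynomials, evaluated at \<open>x 1, \<dots>, x (k - j + 1)\<close>, for \<open>1 \<le> j \<le> k\<close>.\<close>

definition bell_index :: "nat \<Rightarrow> nat \<Rightarrow> (nat \<Rightarrow> nat) set" where
  "bell_index k j = {m \<in> {1..k-j+1} \<rightarrow>\<^sub>E UNIV.
     (\<Sum>i=1..k-j+1. i * m i) = k \<and> (\<Sum>i=1..k-j+1. m i) = j}"

lemma finite_bell_index: "finite (bell_index k j)"
proof (rule finite_subset)
  show "bell_index k j \<subseteq> {1..k-j+1} \<rightarrow>\<^sub>E {..j}"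
  proof
    fix m assume m: "m \<in> bell_index k j"
    have "m i \<le> j" if "i \<in> {1..k-j+1}" for i
      using member_le_sum[of i "{1..k-j+1}" m] that m by (auto simp: bell_index_def)
    then show "m \<in> {1..k-j+1} \<rightarrow>\<^sub>E {..j}"
      using m by (auto simp: bell_index_def PiE_iff)
  qed
qed (simp add: finite_PiE)

definition partial_bell :: "nat \<Rightarrow> nat \<Rightarrow> (nat \<Rightarrow> real) \<Rightarrow> real" where
  "partial_bell k j x =
     (\<Sum>m\<in>bell_index k j. fact k * (\<Prod>i=1..k-j+1. x i ^ m i / (fact (m i) * fact i ^ m i)))"

text \<open>The convention \<open>1 / \<Gamma>(0) = 0\<close> holds for the library's total \<^const>\<open>Gamma\<close>.\<close>

lemma inverse_Gamma_0: "1 / Gamma (0::real) = 0"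
  by simp

end

theory Submission
  imports Defs "HOL-Real_Asymp.Real_Asymp"
begin

text \<open>
  Besides the size \<open>m\<close> of the root cluster, record its weight \<open>w\<close>, the sum of
  \<open>\<alpha> deg\<^sup>+(v) + 1\<close> over its vertices. A new vertex attaches to the cluster with probability
  \<open>w\<close> divided by the total weight of the tree, which is deterministic. If it does, then with
  probability \<open>p\<close> it joins the cluster, and \<open>(m, w)\<close> becomes \<open>(m + 1, w + \<alpha> + 1)\<close>; otherwise it
  only adds to the out-degree of its parent, and \<open>(m, w)\<close> becomes \<open>(m, w + \<alpha>)\<close>. So \<open>(m, w)\<close> is a
  Markov chain (\<open>map_cluster_state_coloured_tree_pmf\<close>), and trees need no longer be considered.

  Up to the total weight, the generator of \<open>w\<close> is
  \<open>g \<mapsto> w (p g(w + \<alpha> + 1) + (1 - p) g(w + \<alpha>) - g(w))\<close>. Applied to a polynomial of degree \<open>k \<ge> 1\<close>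
  it preserves the degree and multiplies the leading coefficient by \<open>k (p + \<alpha>)\<close>, so there is an
  eigenpolynomial \<open>Q\<^sub>k\<close> of each degree, and the mean of \<open>Q\<^sub>k(w)\<close> is \<open>Q\<^sub>k(1)\<close> times an explicit ratio
  of Gamma functions. Splitting the initial weight into independent parts suggests that the
  generating function \<open>\<Sum> Q\<^sub>k(w) x\<^sup>k / k!\<close> is the \<open>w\<close>-th power of a fixed series \<open>h\<close>, and then the
  eigenvalue equations for all \<open>k\<close> and \<open>w\<close> collapse to
  \<open>(p + \<alpha>) x h' = h (p h\<^sup>\<alpha>\<^sup>+\<^sup>1 + (1 - p) h\<^sup>\<alpha> - 1)\<close>. The recursion of the numbers \<open>C\<^sub>k\<close> is this very
  equation in disguise: with \<open>K = \<Sum> C\<^sub>k x\<^sup>k / k!\<close>, Bell polynomials are the coefficients of the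
  powers of \<open>K\<close>, the recursion says \<open>(p + \<alpha>) x K' = \<alpha> (K + h - 1)\<close> for
  \<open>h = (1 - p K)\<^sup>-\<^sup>1\<^sup>/\<^sup>\<alpha>\<close> (\<open>egf_C_ODE\<close>), and this \<open>h\<close> solves the equation above
  (\<open>weight_fps_generator\<close>). Normalised through \<open>C\<^sub>1\<close>, the leading coefficient of \<open>Q\<^sub>k\<close> is
  \<open>(p / (p + \<alpha>))\<^sup>k\<close>, so the \<open>k\<close>-th moment of \<open>p w / (p + \<alpha>)\<close>, divided by
  \<open>n\<^sup>k\<^sup>\<beta>\<close> with \<open>\<beta> = (p + \<alpha>) / (1 + \<alpha>)\<close>, converges to the claimed moment. For \<open>p = 0\<close> these \<open>Q\<^sub>k\<close> and
  the limit moments vanish for \<open>k \<ge> 1\<close>, in accordance with a cluster that consists of the root.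

  The process \<open>(p + \<alpha>) m - p w\<close> is a martingale whose second moment is at most of the order of
  the mean of \<open>w\<close>, that is \<open>n\<^sup>\<beta>\<close>; hence \<open>m\<close> and \<open>p w / (p + \<alpha>)\<close> differ by a negligible
  amount in mean (\<open>scaled_discrepancy_tendsto_0\<close>), and only the latter has to be studied.

  Finally, the series \<open>K\<close> has a positive radius of convergence, and the Gamma function in the
  denominator makes the limit moments so small that their exponential generating function is
  entire. So they determine the limit law, and \<open>method_of_moments\<close> together with Levy's
  continuity theorem give the convergence in distribution.
\<close>

unbundle no vec_syntax
unbundle fps_syntax

section \<open>The method of moments\<close>

lemma abs_min_even_power: "\<bar>min (x ^ (2 * k)) (real n)\<bar> \<le> n" for x :: real
  using zero_le_even_power[of "2 * k" x] by simp

lemma (in real_distribution) integrable_even_power_if_clipped_bounded: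
  assumes bound: "\<And>n::nat. expectation (\<lambda>x. min (x ^ (2 * k)) n) \<le> B"
  shows "integrable M (\<lambda>x. x ^ (2 * k))" "expectation (\<lambda>x. x ^ (2 * k)) \<le> B"
proof -
  let ?f = "\<lambda>(n::nat) x::real. min (x ^ (2 * k)) n"
  have int: "integrable M (?f n)" for n
    by (intro integrable_const_bound[where B = n]) (auto simp: abs_min_even_power)
  have mono: "AE x in M. incseq (\<lambda>n. ?f n x)"
    by (intro AE_I2 incseq_SucI) (auto simp: min_def)
  have lim: "AE x in M. (\<lambda>n. ?f n x) \<longlonglongrightarrow> x ^ (2 * k)"
  proof (intro AE_I2)
    fix x :: real
    obtain N :: nat where N: "x ^ (2 * k) \<le> N"
      using real_arch_simple by blast
    have "eventually (\<lambda>n. ?f n x = x ^ (2 * k)) sequentially"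
      using eventually_ge_at_top[of N] by eventually_elim (use N in linarith)
    then show "(\<lambda>n. ?f n x) \<longlonglongrightarrow> x ^ (2 * k)"
      by (rule tendsto_eventually)
  qed
  have inc: "incseq (\<lambda>n. expectation (?f n))"
    by (intro incseq_SucI integral_mono int) (auto simp: min_def)
  obtain L where L: "(\<lambda>n. expectation (?f n)) \<longlonglongrightarrow> L"
    using incseq_convergent[OF inc] bound by blast
  have hbi: "has_bochner_integral M (\<lambda>x. x ^ (2 * k)) L"
    by (rule has_bochner_integral_monotone_convergence[OF int mono lim L]) simp
  then show "integrable M (\<lambda>x. x ^ (2 * k))"
    by (simp add: has_bochner_integral_iff)
  have "L \<le> B"
    using bound by (intro LIMSEQ_le_const2[OF L]) auto
  with hbi show "expectation (\<lambda>x. x ^ (2 * k)) \<le> B"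
    by (simp add: has_bochner_integral_iff)
qed

lemma (in real_distribution) integrable_power_if_even_power:
  assumes "integrable M (\<lambda>x. x ^ (2 * k))"
  shows "integrable M (\<lambda>x. x ^ k)"
proof (rule Bochner_Integration.integrable_bound)
  show "integrable M (\<lambda>x. 1 + x ^ (2 * k))"
    using assms by simp
  have "\<bar>x ^ k\<bar> \<le> 1 + x ^ (2 * k)" for x :: real
  proof -
    have "x ^ (2 * k) = \<bar>x ^ k\<bar> ^ 2"
      by (simp add: power_mult mult.commute flip: power_mult)
    then show ?thesis
      using sum_squares_bound[of "\<bar>x ^ k\<bar>" 1] by simp
  qed
  then show "AE x in M. norm (x ^ k) \<le> norm (1 + x ^ (2 * k))"
    by (intro AE_I2) (simp add: abs_of_nonneg)
qed auto

text \<open>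
  Clipping at \<open>A\<close> changes \<open>x ^ k\<close> only where \<open>\<bar>x ^ k\<bar> > A\<close>, and there \<open>\<bar>x ^ k\<bar> \<le> x ^ (2 * k) / A\<close>.
  The clipped power is bounded and continuous, hence accessible to weak convergence.
\<close>

lemma (in real_distribution) power_integral_clip_error:
  assumes int: "integrable M (\<lambda>x. x ^ (2 * k))" and A: "A > 0"
  shows "\<bar>expectation (\<lambda>x. x ^ k) - expectation (\<lambda>x. max (- A) (min A (x ^ k)))\<bar>
           \<le> expectation (\<lambda>x. x ^ (2 * k)) / A"
proof -
  let ?g = "\<lambda>x::real. max (- A) (min A (x ^ k))"
  have intk: "integrable M (\<lambda>x. x ^ k)"
    using int by (rule integrable_power_if_even_power)
  have intg: "integrable M ?g"
    using A by (intro integrable_const_bound[where B = A]) auto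
  have err: "\<bar>x ^ k - ?g x\<bar> \<le> x ^ (2 * k) / A" for x :: real
  proof -
    have sq: "x ^ (2 * k) = \<bar>x ^ k\<bar> * \<bar>x ^ k\<bar>"
      by (simp add: mult_2 power_add flip: power2_eq_square)
    show ?thesis
    proof (cases "\<bar>x ^ k\<bar> \<le> A")
      case True
      then have "?g x = x ^ k" by auto
      then show ?thesis using A by simp
    next
      case False
      then have "\<bar>x ^ k - ?g x\<bar> \<le> \<bar>x ^ k\<bar>" using A by auto
      also have "\<bar>x ^ k\<bar> * A \<le> \<bar>x ^ k\<bar> * \<bar>x ^ k\<bar>"
        using False A by (intro mult_left_mono) auto
      then have "\<bar>x ^ k\<bar> \<le> x ^ (2 * k) / A"
        unfolding sq using A by (simp only: pos_le_divide_eq)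
      finally show ?thesis .
    qed
  qed
  have "\<bar>expectation (\<lambda>x. x ^ k) - expectation ?g\<bar> = \<bar>expectation (\<lambda>x. x ^ k - ?g x)\<bar>"
    using intk intg by simp
  also have "\<dots> \<le> expectation (\<lambda>x. \<bar>x ^ k - ?g x\<bar>)"
    by (rule integral_abs_bound)
  also have "\<dots> \<le> expectation (\<lambda>x. x ^ (2 * k) / A)"
    using intk intg int err by (intro integral_mono) auto
  finally show ?thesis by simp
qed

text \<open>
  The moment of order \<open>2 * k\<close> makes the \<open>k\<close>-th power uniformly integrable: the errors of clipping
  at \<open>A\<close> are of order \<open>1 / A\<close>, for the limit law as for all the laws of the sequence.
\<close>

lemma weak_conv_m_moments:
  assumes distr: "\<And>n. real_distribution (\<nu> n)" "real_distribution \<mu>"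
    and conv: "weak_conv_m \<nu> \<mu>"
    and int: "\<And>n k. integrable (\<nu> n) (\<lambda>x. x ^ k)"
    and lim: "\<And>k. (\<lambda>n. \<integral>x. x ^ k \<partial>\<nu> n) \<longlonglongrightarrow> m k"
  shows "integrable \<mu> (\<lambda>x. x ^ k)" "(\<integral>x. x ^ k \<partial>\<mu>) = m k"
proof -
  interpret \<nu>: real_distribution "\<nu> n" for n by (rule distr)
  interpret \<mu>: real_distribution \<mu> by (rule distr)
  have even: "integrable \<mu> (\<lambda>x. x ^ (2 * k))" "(\<integral>x. x ^ (2 * k) \<partial>\<mu>) \<le> m (2 * k)"
  proof -
    have bound: "(\<integral>x. min (x ^ (2 * k)) N \<partial>\<mu>) \<le> m (2 * k)" for N :: nat
    proof (rule LIMSEQ_le)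
      show "(\<lambda>n. \<integral>x. min (x ^ (2 * k)) N \<partial>\<nu> n) \<longlonglongrightarrow> (\<integral>x. min (x ^ (2 * k)) N \<partial>\<mu>)"
        by (rule weak_conv_imp_integral_bdd_continuous_conv[OF distr conv, where B = N])
          (auto intro!: continuous_intros simp: abs_min_even_power)
      show "(\<lambda>n. \<integral>x. x ^ (2 * k) \<partial>\<nu> n) \<longlonglongrightarrow> m (2 * k)"
        by (rule lim)
      have "(\<integral>x. min (x ^ (2 * k)) N \<partial>\<nu> n) \<le> (\<integral>x. x ^ (2 * k) \<partial>\<nu> n)" for n
        by (intro integral_mono int \<nu>.integrable_const_bound[where B = N])
          (auto simp: abs_min_even_power)
      then show "\<exists>N'. \<forall>n\<ge>N'. (\<integral>x. min (x ^ (2 * k)) N \<partial>\<nu> n) \<le> (\<integral>x. x ^ (2 * k) \<partial>\<nu> n)"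
        by blast
    qed
    show "integrable \<mu> (\<lambda>x. x ^ (2 * k))" "(\<integral>x. x ^ (2 * k) \<partial>\<mu>) \<le> m (2 * k)"
      by (rule \<mu>.integrable_even_power_if_clipped_bounded[OF bound])+
  qed
  show "integrable \<mu> (\<lambda>x. x ^ k)"
    using even(1) by (rule \<mu>.integrable_power_if_even_power)
  have le: "\<bar>(\<integral>x. x ^ k \<partial>\<mu>) - m k\<bar> \<le> 2 * m (2 * k) / A" if A: "A > 0" for A
  proof -
    let ?g = "\<lambda>x::real. max (- A) (min A (x ^ k))"
    have "(\<lambda>n. \<integral>x. ?g x \<partial>\<nu> n) \<longlonglongrightarrow> (\<integral>x. ?g x \<partial>\<mu>)"
      using A by (intro weak_conv_imp_integral_bdd_continuous_conv[OF distr conv, where B = A])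
          (auto intro!: continuous_intros)
    with lim[of k] have "(\<lambda>n. \<bar>(\<integral>x. x ^ k \<partial>\<nu> n) - (\<integral>x. ?g x \<partial>\<nu> n)\<bar>) \<longlonglongrightarrow> \<bar>m k - (\<integral>x. ?g x \<partial>\<mu>)\<bar>"
      by (intro tendsto_intros)
    moreover have "(\<lambda>n. (\<integral>x. x ^ (2 * k) \<partial>\<nu> n) / A) \<longlonglongrightarrow> m (2 * k) / A"
      using A by (intro tendsto_intros lim) auto
    ultimately have "\<bar>m k - (\<integral>x. ?g x \<partial>\<mu>)\<bar> \<le> m (2 * k) / A"
      by (rule LIMSEQ_le) (use \<nu>.power_integral_clip_error[OF int A] in blast)
    moreover have "\<bar>(\<integral>x. x ^ k \<partial>\<mu>) - (\<integral>x. ?g x \<partial>\<mu>)\<bar> \<le> (\<integral>x. x ^ (2 * k) \<partial>\<mu>) / A"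
      by (rule \<mu>.power_integral_clip_error[OF even(1) A])
    moreover have "(\<integral>x. x ^ (2 * k) \<partial>\<mu>) / A \<le> m (2 * k) / A"
      using even(2) A by (simp add: divide_right_mono)
    ultimately show ?thesis by linarith
  qed
  have "(\<lambda>n. 2 * m (2 * k) / real (Suc n)) \<longlonglongrightarrow> 0"
    by real_asymp
  then have "\<bar>(\<integral>x. x ^ k \<partial>\<mu>) - m k\<bar> \<le> 0"
    by (rule LIMSEQ_le_const) (intro exI[of _ 0] allI impI le, simp)
  then show "(\<integral>x. x ^ k \<partial>\<mu>) = m k" by simp
qed

lemma tight_if_second_moments_bounded:
  assumes distr: "\<And>n. real_distribution (\<nu> n)"
    and int: "\<And>n. integrable (\<nu> n) (\<lambda>x. x ^ 2)"
    and bound: "\<And>n. (\<integral>x. x ^ 2 \<partial>\<nu> n) \<le> B"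
  shows "tight \<nu>"
  unfolding tight_def
proof (intro conjI allI impI)
  show "real_distribution (\<nu> n)" for n by (rule distr)
  fix \<epsilon> :: real assume \<epsilon>: "\<epsilon> > 0"
  have B: "B \<ge> 0"
    using bound[of 0] by (rule order_trans[rotated]) simp
  define a where "a = 1 + B / \<epsilon>"
  have a: "a \<ge> 1" using B \<epsilon> by (simp add: a_def)
  have "measure (\<nu> n) {-a<..a} > 1 - \<epsilon>" for n
  proof -
    interpret real_distribution "\<nu> n" by (rule distr)
    have "prob (UNIV - {-a<..a}) \<le> prob {x \<in> space (\<nu> n). a ^ 2 \<le> x ^ 2}"
    proof (intro finite_measure_mono subsetI)
      fix x assume "x \<in> UNIV - {-a<..a}"
      then have "a \<le> \<bar>x\<bar>" by auto
      then have "a ^ 2 \<le> \<bar>x\<bar> ^ 2" using a by (intro power_mono) auto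
      then show "x \<in> {x \<in> space (\<nu> n). a ^ 2 \<le> x ^ 2}" by simp
    qed auto
    also have "\<dots> \<le> expectation (\<lambda>x. x ^ 2) / a ^ 2"
      using a by (intro integral_Markov_inequality_measure[where A = "{}"] int) auto
    also have "\<dots> \<le> B / a ^ 2"
      using bound[of n] by (intro divide_right_mono) auto
    also have "B < \<epsilon> * a"
      using \<epsilon> by (simp add: a_def field_simps)
    then have "B < \<epsilon> * a ^ 2"
      using a \<epsilon> by (smt (verit) mult_left_mono power2_eq_square mult_le_cancel_left1 mult.assoc zero_le_mult_iff)
    then have "B / a ^ 2 < \<epsilon>"
      using a by (simp add: field_simps)
    finally show ?thesis
      using prob_compl[of "{-a<..a}"] by simp
  qed
  then show "\<exists>a b. a < b \<and> (\<forall>n. 1 - \<epsilon> < measure (\<nu> n) {a<..b})"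
    using a by (intro exI[of _ "-a"] exI[of _ a]) auto
qed

text \<open>
  Bounded second moments give tightness, so some subsequence converges weakly to a law \<open>\<mu>\<close>, which has
  the moments \<open>m\<close>. Under the growth condition a Taylor polynomial of high order approximates the
  characteristic functions of \<open>\<mu>\<close> and of all late members of the sequence up to the same small
  error, and these polynomials depend on the moments alone. The whole sequence of characteristic
  functions therefore converges.
\<close>

theorem method_of_moments:
  fixes m :: "nat \<Rightarrow> real"
  assumes distr: "\<And>n. real_distribution (\<nu> n)"
    and int: "\<And>n k. integrable (\<nu> n) (\<lambda>x. x ^ k)"
    and lim: "\<And>k. (\<lambda>n. \<integral>x. x ^ k \<partial>\<nu> n) \<longlonglongrightarrow> m k"
    and growth: "\<And>t. (\<lambda>k. t ^ k * m k / fact k) \<longlonglongrightarrow> 0"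
  obtains \<mu> where "real_distribution \<mu>" "\<And>t. (\<lambda>n. char (\<nu> n) t) \<longlonglongrightarrow> char \<mu> t"
    "\<And>k. integrable \<mu> (\<lambda>x. x ^ k)" "\<And>k. (\<integral>x. x ^ k \<partial>\<mu>) = m k"
proof -
  obtain B where B: "\<bar>\<integral>x. x ^ 2 \<partial>\<nu> n\<bar> \<le> B" for n
    using convergent_imp_Bseq[OF convergentI[OF lim[of 2]]] by (auto simp: Bseq_def)
  have "tight \<nu>"
    by (rule tight_if_second_moments_bounded[OF distr int, where B = B]) (use B abs_le_D1 in blast)
  from tight_imp_convergent_subsubsequence[OF this strict_mono_id]
  obtain r \<mu> where r: "strict_mono r" and \<mu>: "real_distribution \<mu>" "weak_conv_m (\<nu> \<circ> r) \<mu>"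
    by auto
  have mom: "integrable \<mu> (\<lambda>x. x ^ k)" "(\<integral>x. x ^ k \<partial>\<mu>) = m k" for k
  proof -
    have sub: "(\<lambda>n. \<integral>x. x ^ k \<partial>(\<nu> \<circ> r) n) \<longlonglongrightarrow> m k" for k
      using LIMSEQ_subseq_LIMSEQ[OF lim r] by (simp add: o_def)
    show "integrable \<mu> (\<lambda>x. x ^ k)" "(\<integral>x. x ^ k \<partial>\<mu>) = m k"
      using distr int by (intro weak_conv_m_moments[OF _ \<mu> _ sub]; simp)+
  qed
  interpret \<mu>: real_distribution \<mu> by (rule \<mu>)
  have "(\<lambda>n. char (\<nu> n) t) \<longlonglongrightarrow> char \<mu> t" for t
  proof (rule metric_LIMSEQ_I)
    fix e :: real assume e: "e > 0"
    \<comment> \<open>An even order makes the absolute moment in the Taylor bound an ordinary one.\<close>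
    have "((\<lambda>k. \<bar>t\<bar> ^ k * m k / fact k) \<circ> (\<lambda>k. 2 * k)) \<longlonglongrightarrow> 0"
      by (rule LIMSEQ_subseq_LIMSEQ[OF growth]) (simp add: strict_mono_def)
    then obtain K where "\<bar>\<bar>t\<bar> ^ (2 * K) * m (2 * K) / fact (2 * K)\<bar> < e / 8"
      using LIMSEQ_D[of _ 0 "e / 8"] e by fastforce
    then have K: "2 * \<bar>t\<bar> ^ (2 * K) / fact (2 * K) * m (2 * K) < e / 4"
      unfolding abs_less_iff by (simp add: field_simps)
    let ?S = "\<lambda>M. \<Sum>k\<le>2 * K. ((\<i> * t) ^ k / fact k) * complex_of_real (\<integral>x. x ^ k \<partial>M)"
    have approx: "cmod (char M t - ?S M) \<le> 2 * \<bar>t\<bar> ^ (2 * K) / fact (2 * K) * (\<integral>x. x ^ (2 * K) \<partial>M)"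
      if "real_distribution M" "\<And>k. integrable M (\<lambda>x. x ^ k)" for M
      using real_distribution.char_approx1[OF that, where n = "2 * K" and t = t]
      unfolding power_even_abs[OF dvd_triv_left] by blast
    have "(\<lambda>n. ?S (\<nu> n)) \<longlonglongrightarrow> ?S \<mu>"
      unfolding mom by (intro tendsto_intros lim)
    then have "eventually (\<lambda>n. dist (?S (\<nu> n)) (?S \<mu>) < e / 4) sequentially"
      using e by (intro tendstoD) auto
    moreover have "(\<lambda>n. 2 * \<bar>t\<bar> ^ (2 * K) / fact (2 * K) * (\<integral>x. x ^ (2 * K) \<partial>\<nu> n))
        \<longlonglongrightarrow> 2 * \<bar>t\<bar> ^ (2 * K) / fact (2 * K) * m (2 * K)"
      by (intro tendsto_intros lim)
    then have "eventually (\<lambda>n. 2 * \<bar>t\<bar> ^ (2 * K) / fact (2 * K) * (\<integral>x. x ^ (2 * K) \<partial>\<nu> n) < e / 4) sequentially"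
      using K by (rule order_tendstoD)
    ultimately have "eventually (\<lambda>n. dist (char (\<nu> n) t) (char \<mu> t) < e) sequentially"
    proof eventually_elim
      case (elim n)
      have "cmod (char (\<nu> n) t - ?S (\<nu> n)) < e / 4"
        using approx[OF distr int, of n] elim(2) by linarith
      moreover have "cmod (char \<mu> t - ?S \<mu>) < e / 4"
        using approx[OF \<mu>(1) mom(1)] K unfolding mom by linarith
      moreover have "cmod (char (\<nu> n) t - char \<mu> t) \<le> cmod (char (\<nu> n) t - ?S (\<nu> n)) +
          cmod (?S (\<nu> n) - ?S \<mu>) + cmod (char \<mu> t - ?S \<mu>)"
        using norm_triangle_ineq[of "char (\<nu> n) t - ?S (\<nu> n)" "?S (\<nu> n) - ?S \<mu>"]
          norm_triangle_ineq4[of "char (\<nu> n) t - ?S \<mu>" "char \<mu> t - ?S \<mu>"]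
        by simp
      ultimately show ?case
        using elim(1) e by (simp add: dist_norm)
    qed
    then show "\<exists>N. \<forall>n\<ge>N. dist (char (\<nu> n) t) (char \<mu> t) < e"
      by (simp add: eventually_sequentially)
  qed
  then show thesis
    using that \<mu>(1) mom by blast
qed

text \<open>
  The function \<open>x \<mapsto> exp (i t x)\<close> is Lipschitz with constant \<open>\<bar>t\<bar>\<close>, so random variables that are
  close in mean have close characteristic functions.
\<close>

lemma char_distr_diff_bound:
  fixes X Y :: "'a \<Rightarrow> real"
  assumes "finite (set_pmf P)"
  shows "cmod (char (distr (measure_pmf P) borel X) t - char (distr (measure_pmf P) borel Y) t)
    \<le> \<bar>t\<bar> * measure_pmf.expectation P (\<lambda>x. \<bar>X x - Y x\<bar>)"
proof -
  have int: "integrable (measure_pmf P) f" for f :: "'a \<Rightarrow> complex"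
    using assms by (rule integrable_measure_pmf_finite)
  have int': "integrable (measure_pmf P) f" for f :: "'a \<Rightarrow> real"
    using assms by (rule integrable_measure_pmf_finite)
  have "char (distr (measure_pmf P) borel X) t - char (distr (measure_pmf P) borel Y) t
    = (\<integral>x. iexp (t * X x) - iexp (t * Y x) \<partial>measure_pmf P)"
    by (simp add: char_def integral_distr int Bochner_Integration.integral_diff)
  also have "cmod \<dots> \<le> (\<integral>x. cmod (iexp (t * X x) - iexp (t * Y x)) \<partial>measure_pmf P)"
    by (rule integral_norm_bound)
  also have "\<dots> \<le> (\<integral>x. \<bar>t\<bar> * \<bar>X x - Y x\<bar> \<partial>measure_pmf P)"
  proof (rule integral_mono[OF int' int'])
    fix x
    have "iexp (t * X x) - iexp (t * Y x) = iexp (t * Y x) * (iexp (t * X x - t * Y x) - 1)"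
      by (simp add: algebra_simps flip: exp_add)
    then have "cmod (iexp (t * X x) - iexp (t * Y x)) = cmod (iexp (t * X x - t * Y x) - 1)"
      by (simp add: norm_mult)
    also have "\<dots> \<le> \<bar>t * X x - t * Y x\<bar>"
      using iexp_approx1[of "t * X x - t * Y x" 0] by simp
    also have "\<dots> = \<bar>t\<bar> * \<bar>X x - Y x\<bar>"
      by (simp add: abs_mult flip: right_diff_distrib)
    finally show "cmod (iexp (t * X x) - iexp (t * Y x)) \<le> \<bar>t\<bar> * \<bar>X x - Y x\<bar>" .
  qed
  finally show ?thesis by simp
qed

section \<open>Bell polynomials as coefficients of powers\<close>

text \<open>The functions are undefined outside \<open>A\<close>, as are the members of \<^const>\<open>bell_index\<close>.\<close>

definition exponents :: "'i set \<Rightarrow> nat \<Rightarrow> ('i \<Rightarrow> nat) set" where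
  "exponents A j = {m \<in> A \<rightarrow>\<^sub>E UNIV. sum m A = j}"

lemma finite_exponents:
  assumes "finite A"
  shows "finite (exponents A j)"
proof (rule finite_subset)
  show "exponents A j \<subseteq> A \<rightarrow>\<^sub>E {..j}"
  proof
    fix m assume m: "m \<in> exponents A j"
    have "m i \<le> sum m A" if "i \<in> A" for i
      using that assms by (intro member_le_sum) auto
    with m show "m \<in> A \<rightarrow>\<^sub>E {..j}"
      by (auto simp: exponents_def PiE_iff)
  qed
qed (use assms in \<open>simp add: finite_PiE\<close>)

lemma exponents_empty: "exponents {} j = (if j = 0 then {\<lambda>_. undefined} else {})"
  by (auto simp: exponents_def)

lemma sum_exponents_insert:
  assumes "finite A" "a \<notin> A"
  shows "sum g (exponents (insert a A) j) =
    (\<Sum>l\<le>j. \<Sum>m\<in>exponents A (j - l). g (m(a := l)))"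
proof -
  have upd: "(\<Sum>x\<in>A. if x = a then l else m x) = sum m A" for m :: "'a \<Rightarrow> nat" and l
    using assms by (intro sum.cong) auto
  have "sum g (exponents (insert a A) j) =
    (\<Sum>(l, m)\<in>Sigma {..j} (\<lambda>l. exponents A (j - l)). g (m(a := l)))"
  proof (rule sum.reindex_bij_witness
      [where j = "\<lambda>m. (m a, m(a := undefined))" and i = "\<lambda>(l, m). m(a := l)"])
    fix m assume m: "m \<in> exponents (insert a A) j"
    show "(m a, m(a := undefined)) \<in> Sigma {..j} (\<lambda>l. exponents A (j - l))"
      using m assms by (auto simp: exponents_def PiE_def extensional_def upd)
  next
    fix b assume "b \<in> Sigma {..j} (\<lambda>l. exponents A (j - l))"
    then show "(\<lambda>m. (m a, m(a := undefined))) (case b of (l, m) \<Rightarrow> m(a := l)) = b"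
      using assms by (auto simp: exponents_def PiE_def extensional_def fun_eq_iff)
    show "(case b of (l, m) \<Rightarrow> m(a := l)) \<in> exponents (insert a A) j"
      using \<open>b \<in> _\<close> assms by (auto simp: exponents_def PiE_def extensional_def upd)
  qed auto
  also have "\<dots> = (\<Sum>l\<le>j. \<Sum>m\<in>exponents A (j - l). g (m(a := l)))"
    by (rule sum.Sigma[symmetric]) (auto simp: finite_exponents assms)
  finally show ?thesis .
qed

text \<open>
  Induction over \<open>A\<close> with the binomial theorem: the exponent of the inserted index is the summation
  index of the latter. The weights \<open>1 / fact (m i)\<close> stay with the factors because this is the
  shape of the Bell polynomials.
\<close>

lemma fps_multinomial:
  fixes f :: "'i \<Rightarrow> 'a::field_char_0 fps"
  assumes "finite A"
  shows "(\<Sum>i\<in>A. f i) ^ j =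
    (\<Sum>m\<in>exponents A j. fps_const (fact j) * (\<Prod>i\<in>A. fps_const (1 / fact (m i)) * f i ^ m i))"
  using assms
proof (induction A arbitrary: j rule: finite_induct)
  case empty
  then show ?case by (simp add: exponents_empty)
next
  case (insert a A)
  have "(\<Sum>i\<in>insert a A. f i) ^ j = (\<Sum>l\<le>j. of_nat (j choose l) * f a ^ l * (\<Sum>i\<in>A. f i) ^ (j - l))"
    using insert by (simp add: binomial_ring)
  also have "\<dots> = (\<Sum>l\<le>j. \<Sum>m\<in>exponents A (j - l). fps_const (fact j) *
      (\<Prod>i\<in>insert a A. fps_const (1 / fact ((m(a := l)) i)) * f i ^ ((m(a := l)) i)))"
  proof (intro sum.cong refl)
    fix l assume "l \<in> {..j}"
    then have l: "l \<le> j" by simp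
    have "of_nat (j choose l) * f a ^ l * (\<Sum>i\<in>A. f i) ^ (j - l) =
      (\<Sum>m\<in>exponents A (j - l). of_nat (j choose l) * f a ^ l *
        (fps_const (fact (j - l)) * (\<Prod>i\<in>A. fps_const (1 / fact (m i)) * f i ^ m i)))"
      by (subst insert.IH) (rule sum_distrib_left)
    also have "\<dots> = (\<Sum>m\<in>exponents A (j - l). fps_const (fact j) *
      (\<Prod>i\<in>insert a A. fps_const (1 / fact ((m(a := l)) i)) * f i ^ ((m(a := l)) i)))"
    proof (intro sum.cong refl)
      fix m
      have "(\<Prod>i\<in>A. fps_const (1 / fact ((m(a := l)) i)) * f i ^ ((m(a := l)) i)) =
        (\<Prod>i\<in>A. fps_const (1 / fact (m i)) * f i ^ m i)"
        using insert by (intro prod.cong) auto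
      moreover have "of_nat (j choose l) * fps_const (fact (j - l)) =
        fps_const (fact j) * fps_const (1 / fact l :: 'a)"
        by (simp add: binomial_fact[OF l] fps_of_nat[symmetric] field_simps)
      ultimately show "of_nat (j choose l) * f a ^ l *
        (fps_const (fact (j - l)) * (\<Prod>i\<in>A. fps_const (1 / fact (m i)) * f i ^ m i)) =
        fps_const (fact j) * (\<Prod>i\<in>insert a A. fps_const (1 / fact ((m(a := l)) i)) * f i ^ ((m(a := l)) i))"
        using insert by (simp add: mult_ac)
    qed
    finally show "of_nat (j choose l) * f a ^ l * (\<Sum>i\<in>A. f i) ^ (j - l) = \<dots>" .
  qed
  also have "\<dots> = (\<Sum>m\<in>exponents (insert a A) j. fps_const (fact j) *
      (\<Prod>i\<in>insert a A. fps_const (1 / fact (m i)) * f i ^ m i))"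
    by (rule sum_exponents_insert[symmetric]) (use insert in auto)
  finally show ?case .
qed

lemma fps_power_nth_cong:
  fixes f g :: "'a::comm_semiring_1 fps"
  assumes "\<And>i. i \<le> n \<Longrightarrow> f $ i = g $ i" "k \<le> n"
  shows "(f ^ j) $ k = (g ^ j) $ k"
  using assms(2)
proof (induction j arbitrary: k)
  case (Suc j)
  show ?case
    unfolding power_Suc fps_mult_nth
    by (intro sum.cong refl arg_cong2[where f = "(*)"] Suc.IH assms(1)) (use Suc.prems in auto)
qed simp

text \<open>
  Each of the \<open>j\<close> factors contributes at least one power of the variable, so that none of them
  contributes more than \<open>k - j + 1\<close> of them. This is why the partial Bell polynomials have only
  \<open>k - j + 1\<close> arguments.
\<close>

lemma fps_power_nth_cong_zero_constant:
  fixes f g :: "'a::comm_ring_1 fps"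
  assumes "f $ 0 = 0" "g $ 0 = 0" "\<And>i. i \<in> {1..k - j + 1} \<Longrightarrow> f $ i = g $ i" "j \<le> k"
  shows "(f ^ j) $ k = (g ^ j) $ k"
proof -
  have shift: "(h ^ j) $ k = (fps_shift 1 h ^ j) $ (k - j)" if "h $ 0 = 0" for h :: "'a fps"
  proof -
    have "h = fps_X * fps_shift 1 h"
      using that by (intro fps_ext) simp
    then have "h ^ j = fps_X ^ j * fps_shift 1 h ^ j"
      by (metis power_mult_distrib)
    then show ?thesis
      using assms(4) by (simp add: fps_X_power_mult_nth)
  qed
  show ?thesis
    unfolding shift[OF assms(1)] shift[OF assms(2)]
    by (rule fps_power_nth_cong[where n = "k - j"]) (use assms(3) in auto)
qed

text \<open>The constant term is \<open>0\<close> whatever the value of \<open>x 0\<close>, so that the series can be substituted.\<close>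

definition egf :: "(nat \<Rightarrow> real) \<Rightarrow> real fps" where
  "egf x = Abs_fps (\<lambda>k. if k = 0 then 0 else x k / fact k)"

lemma egf_nth: "egf x $ k = (if k = 0 then 0 else x k / fact k)"
  by (simp add: egf_def)

lemma egf_power_nth:
  assumes "j \<le> k"
  shows "(egf x ^ j) $ k = fact j / fact k * partial_bell k j x"
proof -
  define A where "A = {1..k - j + 1}"
  have A: "finite A" by (simp add: A_def)
  let ?f = "\<lambda>i. fps_const (x i / fact i) * fps_X ^ i"
  have "(egf x ^ j) $ k = ((\<Sum>i\<in>A. ?f i) ^ j) $ k"
  proof (rule fps_power_nth_cong_zero_constant)
    show "egf x $ i = (\<Sum>i\<in>A. ?f i) $ i" if "i \<in> {1..k - j + 1}" for i
    proof -
      have "(\<Sum>i\<in>A. ?f i) $ i = (\<Sum>l\<in>A. if l = i then x l / fact l else 0)"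
        unfolding fps_sum_nth by (intro sum.cong) auto
      then show ?thesis
        using that by (simp add: egf_nth A_def)
    qed
  qed (use assms in \<open>auto simp: egf_nth fps_sum_nth A_def\<close>)
  also have "\<dots> = (\<Sum>m\<in>exponents A j. fact j *
    (if (\<Sum>i\<in>A. i * m i) = k then \<Prod>i\<in>A. x i ^ m i / (fact (m i) * fact i ^ m i) else 0))"
    unfolding fps_multinomial[OF A] fps_sum_nth
  proof (intro sum.cong refl)
    fix m
    have "(\<Prod>i\<in>B. fps_const (1 / fact (m i)) * ?f i ^ m i) =
      fps_const (\<Prod>i\<in>B. x i ^ m i / (fact (m i) * fact i ^ m i)) * fps_X ^ (\<Sum>i\<in>B. i * m i)"
      if "finite B" for B
      using that
    proof (induction B rule: finite_induct)
      case (insert b B)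
      have "fps_const (1 / fact (m b)) * ?f b ^ m b =
        fps_const (x b ^ m b / (fact (m b) * fact b ^ m b)) * fps_X ^ (b * m b)"
        by (simp add: power_mult_distrib fps_const_power power_divide power_mult flip: mult.assoc)
      with insert show ?case
        by (simp add: power_add mult_ac flip: fps_const_mult)
    qed simp
    from this[OF A] show "(fps_const (fact j) * (\<Prod>i\<in>A. fps_const (1 / fact (m i)) * ?f i ^ m i)) $ k =
      fact j * (if (\<Sum>i\<in>A. i * m i) = k then \<Prod>i\<in>A. x i ^ m i / (fact (m i) * fact i ^ m i) else 0)"
      by simp
  qed
  also have "\<dots> = (\<Sum>m\<in>exponents A j.
    if (\<Sum>i\<in>A. i * m i) = k then fact j * (\<Prod>i\<in>A. x i ^ m i / (fact (m i) * fact i ^ m i)) else 0)"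
    by (intro sum.cong) auto
  also have "\<dots> = (\<Sum>m\<in>bell_index k j. fact j * (\<Prod>i\<in>A. x i ^ m i / (fact (m i) * fact i ^ m i)))"
    unfolding sum.inter_filter[OF finite_exponents[OF A], symmetric]
    by (intro sum.cong) (auto simp: exponents_def bell_index_def A_def)
  also have "\<dots> = fact j / fact k * partial_bell k j x"
    by (simp add: partial_bell_def A_def sum_distrib_left)
  finally show ?thesis .
qed

section \<open>The series \<open>(1 - X) ^ (- a)\<close>\<close>

definition neg_power_fps :: "real \<Rightarrow> real fps" where
  "neg_power_fps a = Abs_fps (\<lambda>j. pochhammer a j / fact j)"

lemma neg_power_fps_eq_binomial: "neg_power_fps a = fps_binomial (- a) oo (- fps_X)"
  by (simp add: neg_power_fps_def fps_compose_uminus' gbinomial_pochhammer flip: power_mult_distrib mult.assoc)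

lemma neg_power_fps_add: "neg_power_fps (a + b) = neg_power_fps a * neg_power_fps b"
proof -
  have "fps_binomial (- (a + b)) = fps_binomial (- a) * fps_binomial (- b)"
    using fps_binomial_add_mult[of "- a" "- b"] by simp
  then show ?thesis
    by (simp add: neg_power_fps_eq_binomial fps_compose_mult_distrib)
qed

lemma neg_power_fps_minus_1: "neg_power_fps (-1) = 1 - fps_X"
  by (simp add: neg_power_fps_eq_binomial fps_binomial_1 fps_compose_add_distrib)

lemma fps_deriv_neg_power_fps: "fps_deriv (neg_power_fps a) = fps_const a * neg_power_fps (a + 1)"
proof (rule fps_ext)
  fix n
  have "real (Suc n) * (pochhammer a (Suc n) / fact (Suc n)) = a * (pochhammer (a + 1) n / fact n)"
    by (simp add: pochhammer_rec fact_Suc divide_simps del: of_nat_Suc)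
  then show "fps_deriv (neg_power_fps a) $ n = (fps_const a * neg_power_fps (a + 1)) $ n"
    by (simp add: neg_power_fps_def)
qed

section \<open>Majorants for powers of series with nonnegative coefficients\<close>

definition partial_sum :: "real \<Rightarrow> nat \<Rightarrow> real fps \<Rightarrow> real" where
  "partial_sum r N f = (\<Sum>k\<le>N. f $ k * r ^ k)"

lemma fps_mult_nth_nonneg:
  fixes f g :: "real fps"
  assumes "\<And>k. f $ k \<ge> 0" "\<And>k. g $ k \<ge> 0"
  shows "(f * g) $ k \<ge> 0"
  unfolding fps_mult_nth using assms by (intro sum_nonneg mult_nonneg_nonneg)

lemma fps_power_nth_nonneg:
  fixes f :: "real fps"
  assumes "\<And>k. f $ k \<ge> 0"
  shows "(f ^ j) $ k \<ge> 0"
  using assms by (induction j arbitrary: k) (auto intro: fps_mult_nth_nonneg)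

text \<open>
  Without constant terms, the coefficients up to \<open>Suc N\<close> of a product involve only the
  coefficients up to \<open>N\<close> of the factors. The gain of one index is what allows an induction over
  \<open>N\<close> for series that satisfy an equation with at least quadratic right-hand side.
\<close>

lemma partial_sum_mult:
  assumes f: "f $ 0 = 0" "\<And>k. f $ k \<ge> 0" and g: "g $ 0 = 0" "\<And>k. g $ k \<ge> 0" and r: "r \<ge> 0"
  shows "partial_sum r (Suc N) (f * g) \<le> partial_sum r N f * partial_sum r N g"
proof -
  let ?t = "\<lambda>(i, l). (f $ i * r ^ i) * (g $ l * r ^ l)"
  have "partial_sum r (Suc N) (f * g) = (\<Sum>k\<le>Suc N. \<Sum>i\<le>k. ?t (i, k - i))"
    unfolding partial_sum_def fps_mult_nth sum_distrib_right atMost_atLeast0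
  proof (intro sum.cong refl)
    fix k i :: nat assume "i \<in> {0..k}"
    then have "r ^ k = r ^ i * r ^ (k - i)"
      by (simp flip: power_add)
    then show "f $ i * g $ (k - i) * r ^ k = ?t (i, k - i)" by simp
  qed
  also have "\<dots> = sum ?t {(i, l). i + l \<le> Suc N}"
    by (simp add: sum.triangle_reindex_eq flip: case_prod_unfold)
  also have "\<dots> = sum ?t ({(i, l). i + l \<le> Suc N} \<inter> {..N} \<times> {..N})"
  proof (rule sum.mono_neutral_right)
    show "finite {(i, l). i + l \<le> Suc N}"
      by (rule finite_subset[of _ "{..Suc N} \<times> {..Suc N}"]) auto
    show "\<forall>x\<in>{(i, l). i + l \<le> Suc N} - {(i, l). i + l \<le> Suc N} \<inter> {..N} \<times> {..N}. ?t x = 0"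
    proof
      fix x assume "x \<in> {(i, l). i + l \<le> Suc N} - {(i, l). i + l \<le> Suc N} \<inter> {..N} \<times> {..N}"
      then obtain i l where x: "x = (i, l)" "i + l \<le> Suc N" "\<not> (i \<le> N \<and> l \<le> N)"
        by auto
      then have "i = 0 \<or> l = 0" by linarith
      then show "?t x = 0" using f g x by auto
    qed
  qed auto
  also have "\<dots> \<le> sum ?t ({..N} \<times> {..N})"
    using f g r by (intro sum_mono2) auto
  also have "\<dots> = partial_sum r N f * partial_sum r N g"
    by (simp add: partial_sum_def sum_product sum.cartesian_product)
  finally show ?thesis .
qed

lemma partial_sum_power:
  assumes f: "f $ 0 = 0" "\<And>k. f $ k \<ge> 0" and r: "r \<ge> 0" and j: "j \<ge> 2"
  shows "partial_sum r (Suc N) (f ^ j) \<le> partial_sum r N f ^ j"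
  using j
proof (induction j rule: dec_induct)
  case base
  show ?case
    using partial_sum_mult[OF f f r] by (simp add: power2_eq_square)
next
  case (step j)
  have nonneg: "partial_sum r N f \<ge> 0"
    unfolding partial_sum_def using f r by (intro sum_nonneg) auto
  have "partial_sum r (Suc N) (f * f ^ j) \<le> partial_sum r N f * partial_sum r N (f ^ j)"
    using step f r by (intro partial_sum_mult fps_power_nth_nonneg) (auto simp: fps_power_zeroth)
  also have "partial_sum r N (f ^ j) \<le> partial_sum r (Suc N) (f ^ j)"
    using f r by (simp add: partial_sum_def fps_power_nth_nonneg)
  also note step.IH
  finally show ?case
    using nonneg by (simp add: mult_left_mono)
qed

lemma geometric_tail_le:
  fixes x :: real
  assumes "0 \<le> x" "x < 1"
  shows "(\<Sum>j=2..Suc N. x ^ j) \<le> x ^ 2 / (1 - x)"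
proof -
  have "(1 - x) * (\<Sum>j=2..Suc N. x ^ j) \<le> x ^ 2 - x ^ (Suc N + 1)"
  proof (induction N)
    case 0
    then show ?case by (simp add: power2_eq_square)
  next
    case (Suc N)
    have "(\<Sum>j=2..Suc (Suc N). x ^ j) = (\<Sum>j=2..Suc N. x ^ j) + x ^ Suc (Suc N)"
      by simp
    with Suc show ?case by (simp add: algebra_simps)
  qed
  also have "\<dots> \<le> x ^ 2"
    using assms by simp
  finally show ?thesis
    using assms by (simp add: field_simps)
qed

section \<open>Eigenpolynomials of the cluster weight\<close>

locale cluster_moments =
  fixes \<alpha> p :: real and C :: "nat \<Rightarrow> real"
  assumes \<alpha>: "\<alpha> > 0" and p: "0 \<le> p" "p \<le> 1"
    and C_1: "C 1 = \<alpha> / (p + \<alpha>)"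
    and C_rec: "\<And>k. k \<ge> 2 \<Longrightarrow>
      (real k - 1) * (p / \<alpha> + 1) * C k =
        (\<Sum>j=2..k. p ^ j * Gamma (1 / \<alpha> + real j) / Gamma (1 / \<alpha>) * partial_bell k j C)"
begin

text \<open>
  This is the series \<open>(1 - p K) ^ (- w / \<alpha>)\<close> with \<open>K = egf C\<close>, which is \<open>h ^ w\<close> for
  \<open>h = weight_fps 1\<close>. Its coefficients are, up to the factors \<open>fact k\<close>, eigenfunctions of the
  cluster weight.
\<close>

definition weight_fps :: "real \<Rightarrow> real fps" where
  "weight_fps w = neg_power_fps (w / \<alpha>) oo (fps_const p * egf C)"

lemma weight_fps_add: "weight_fps (v + w) = weight_fps v * weight_fps w"
  by (simp add: weight_fps_def add_divide_distrib neg_power_fps_add fps_compose_mult_distrib egf_nth)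

lemma weight_fps_minus_\<alpha>: "weight_fps (- \<alpha>) = 1 - fps_const p * egf C"
  using \<alpha> by (simp add: weight_fps_def neg_power_fps_minus_1 fps_compose_sub_distrib egf_nth)

lemma fps_deriv_weight_fps: "fps_deriv (weight_fps w) = fps_const (w * p / \<alpha>) * weight_fps (w + \<alpha>) * fps_deriv (egf C)"
proof -
  have "fps_deriv (weight_fps w) = (fps_const (w / \<alpha>) * neg_power_fps (w / \<alpha> + 1) oo (fps_const p * egf C)) *
      (fps_const p * fps_deriv (egf C))"
    by (simp add: weight_fps_def fps_compose_deriv egf_nth fps_deriv_neg_power_fps)
  also have "\<dots> = fps_const (w * p / \<alpha>) * weight_fps (w + \<alpha>) * fps_deriv (egf C)"
    using \<alpha> by (simp add: weight_fps_def fps_compose_mult_distrib egf_nth add_divide_distrib mult_ac flip: fps_const_mult)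
  finally show ?thesis .
qed

lemma weight_fps_nth: "weight_fps w $ k = (\<Sum>j\<le>k. pochhammer (w / \<alpha>) j / fact j * p ^ j * (egf C ^ j) $ k)"
  by (simp add: weight_fps_def fps_compose_nth neg_power_fps_def power_mult_distrib fps_const_power atMost_atLeast0 mult.assoc)

text \<open>
  In the expansion of \<open>(1 - p K) ^ (- 1 / \<alpha>)\<close> the quotients of Gamma functions are rising
  factorials and the Bell polynomials are coefficients of powers of \<open>K\<close>.
\<close>

lemma C_rec_coeff:
  assumes "k \<ge> 2"
  shows "(\<Sum>j=2..k. pochhammer (1 / \<alpha>) j / fact j * p ^ j * (egf C ^ j) $ k) =
    (real k - 1) * (p / \<alpha> + 1) * C k / fact k"
proof -
  have "1 / \<alpha> \<notin> \<int>\<^sub>\<le>\<^sub>0"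
    using \<alpha> nonpos_Ints_nonpos[of "1 / \<alpha>"] by auto
  then have poch: "Gamma (1 / \<alpha> + real j) / Gamma (1 / \<alpha>) = pochhammer (1 / \<alpha>) j" for j
    by (simp add: pochhammer_Gamma)
  show ?thesis
    unfolding C_rec[OF assms] sum_divide_distrib times_divide_eq_right[symmetric] poch
    by (intro sum.cong) (auto simp: egf_power_nth)
qed

text \<open>
  At index \<open>k \<ge> 2\<close> this is the recursion, once the linear term \<open>p / \<alpha> * K\<close> of \<open>weight_fps 1\<close> is split
  off. At index \<open>1\<close> both sides agree whatever \<open>C 1\<close> is, which reflects that the equation is invariant
  under rescaling the variable.
\<close>

lemma egf_C_ODE:
  "fps_const (p + \<alpha>) * fps_X * fps_deriv (egf C) = fps_const \<alpha> * (egf C + weight_fps 1 - 1)"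
proof (rule fps_ext)
  fix k
  have "(p + \<alpha>) * k * egf C $ k = \<alpha> * (egf C $ k + weight_fps 1 $ k - (if k = 0 then 1 else 0))"
  proof (cases "k \<ge> 2")
    case False
    then consider "k = 0" | "k = 1" by linarith
    then show ?thesis
      by cases (use \<alpha> in \<open>simp_all add: weight_fps_nth egf_nth field_simps\<close>)
  next
    case True
    have "weight_fps 1 $ k = (\<Sum>j\<in>{0, 1} \<union> {2..k}. pochhammer (1 / \<alpha>) j / fact j * p ^ j * (egf C ^ j) $ k)"
      unfolding weight_fps_nth using True by (intro sum.cong) auto
    also have "\<dots> = p / \<alpha> * (C k / fact k) +
        (\<Sum>j=2..k. pochhammer (1 / \<alpha>) j / fact j * p ^ j * (egf C ^ j) $ k)"
      using True by (subst sum.union_disjoint) (auto simp: egf_nth)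
    also have "(\<Sum>j=2..k. pochhammer (1 / \<alpha>) j / fact j * p ^ j * (egf C ^ j) $ k) =
        (real k - 1) * (p / \<alpha> + 1) * C k / fact k"
      by (rule C_rec_coeff[OF True])
    finally have "weight_fps 1 $ k = p / \<alpha> * (C k / fact k) + (real k - 1) * (p / \<alpha> + 1) * C k / fact k" .
    then show ?thesis
      using True \<alpha> by (simp add: egf_nth field_simps)
  qed
  then show "(fps_const (p + \<alpha>) * fps_X * fps_deriv (egf C)) $ k = (fps_const \<alpha> * (egf C + weight_fps 1 - 1)) $ k"
    by (cases "k = 0") (simp_all add: mult.assoc)
qed

text \<open>
  Differentiating \<open>(1 - p K) ^ (- w / \<alpha>)\<close> produces the factor \<open>X * K'\<close>, which the differential
  equation of \<open>K\<close> replaces by \<open>K + weight_fps 1 - 1\<close>; and \<open>p K\<close> equals \<open>1 - weight_fps (- \<alpha>)\<close>. All that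
  remains are products of series \<open>weight_fps\<close>, in which the exponents add up.
\<close>

lemma weight_fps_generator:
  "fps_const (p + \<alpha>) * fps_X * fps_deriv (weight_fps w) =
    fps_const w * (fps_const p * weight_fps (w + (\<alpha> + 1)) + fps_const (1 - p) * weight_fps (w + \<alpha>) - weight_fps w)"
proof -
  have "fps_const (p + \<alpha>) * fps_X * fps_deriv (weight_fps w) =
    fps_const (w * p / \<alpha>) * weight_fps (w + \<alpha>) * (fps_const (p + \<alpha>) * fps_X * fps_deriv (egf C))"
    by (simp add: fps_deriv_weight_fps mult_ac)
  also have "\<dots> = fps_const (w * p / \<alpha>) * weight_fps (w + \<alpha>) * (fps_const \<alpha> * (egf C + weight_fps 1 - 1))"
    by (simp only: egf_C_ODE)
  also have "\<dots> = fps_const (w * p / \<alpha> * \<alpha>) * weight_fps (w + \<alpha>) * (egf C + weight_fps 1 - 1)"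
    by (simp only: mult_ac flip: fps_const_mult)
  also have "\<dots> = fps_const w * weight_fps (w + \<alpha>) * (fps_const p * egf C + fps_const p * weight_fps 1 - fps_const p)"
    using \<alpha> by (simp add: algebra_simps flip: fps_const_mult)
  also have "fps_const p * egf C = 1 - weight_fps (- \<alpha>)"
    by (simp add: weight_fps_minus_\<alpha>)
  also have "fps_const w * weight_fps (w + \<alpha>) * (1 - weight_fps (- \<alpha>) + fps_const p * weight_fps 1 - fps_const p) =
    fps_const w * (fps_const p * (weight_fps (w + \<alpha>) * weight_fps 1) + (1 - fps_const p) * weight_fps (w + \<alpha>) - weight_fps (w + \<alpha>) * weight_fps (- \<alpha>))"
    by (simp add: algebra_simps)
  also have "\<dots> = fps_const w * (fps_const p * weight_fps (w + (\<alpha> + 1)) + fps_const (1 - p) * weight_fps (w + \<alpha>) - weight_fps w)"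
    by (simp add: add.assoc flip: weight_fps_add fps_const_1_eq_1)
  finally show ?thesis .
qed

definition eigen :: "nat \<Rightarrow> real \<Rightarrow> real" where
  "eigen k w = fact k * weight_fps w $ k"

lemma eigen_generator:
  "w * (p * eigen k (w + (\<alpha> + 1)) + (1 - p) * eigen k (w + \<alpha>) - eigen k w) = k * (p + \<alpha>) * eigen k w"
proof -
  have "(fps_const (p + \<alpha>) * fps_X * fps_deriv (weight_fps w)) $ k =
    (fps_const w * (fps_const p * weight_fps (w + (\<alpha> + 1)) + fps_const (1 - p) * weight_fps (w + \<alpha>) - weight_fps w)) $ k"
    by (simp only: weight_fps_generator)
  then have "(p + \<alpha>) * (k * weight_fps w $ k) =
    w * (p * weight_fps (w + (\<alpha> + 1)) $ k + (1 - p) * weight_fps (w + \<alpha>) $ k - weight_fps w $ k)"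
    by (cases k) (simp_all add: mult.assoc)
  from arg_cong[OF this, of "\<lambda>x. fact k * x"] show ?thesis
    by (simp add: eigen_def algebra_simps)
qed

text \<open>
  The start of the chain enters the moments through \<open>eigen k 1\<close>, and the differential equation
  expresses the coefficients of \<open>weight_fps 1\<close> by those of \<open>K\<close>.
\<close>

lemma eigen_1:
  assumes "k \<ge> 1"
  shows "\<alpha> * eigen k 1 = (k * (p + \<alpha>) - \<alpha>) * C k"
proof -
  have "(fps_const (p + \<alpha>) * fps_X * fps_deriv (egf C)) $ k = (fps_const \<alpha> * (egf C + weight_fps 1 - 1)) $ k"
    by (simp only: egf_C_ODE)
  then have "(p + \<alpha>) * (k * (C k / fact k)) = \<alpha> * (C k / fact k + weight_fps 1 $ k)"
    using assms by (cases k) (simp_all add: mult.assoc egf_nth del: fact_Suc of_nat_Suc)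
  then show ?thesis
    by (simp add: eigen_def field_simps)
qed

text \<open>
  As a function of \<open>w\<close>, the coefficient of \<open>(p K) ^ j\<close> in \<open>weight_fps w\<close> is a rising factorial of
  \<open>w / \<alpha>\<close>; taking the rising factorial in the ring of polynomials exhibits its degree.
\<close>

definition rising_poly :: "nat \<Rightarrow> real poly" where
  "rising_poly j = pochhammer [:0, 1 / \<alpha>:] j"

lemma poly_rising_poly: "poly (rising_poly j) w = pochhammer (w / \<alpha>) j"
  by (induction j) (simp_all add: rising_poly_def pochhammer_Suc algebra_simps)

lemma rising_poly_degree: "degree (rising_poly j) \<le> j" "coeff (rising_poly j) j = (1 / \<alpha>) ^ j"
proof (induction j)
  case (Suc j)
  have eq: "rising_poly (Suc j) = rising_poly j * [:real j, 1 / \<alpha>:]"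
    by (simp add: rising_poly_def pochhammer_Suc of_nat_poly)
  have "degree (rising_poly (Suc j)) \<le> degree (rising_poly j) + degree [:real j, 1 / \<alpha>:]"
    unfolding eq by (rule degree_mult_le)
  with Suc.IH(1) show "degree (rising_poly (Suc j)) \<le> Suc j"
    by (simp split: if_splits)
  have "coeff (rising_poly j) (Suc j) = 0"
    using Suc.IH(1) by (intro coeff_eq_0) simp
  with Suc.IH(2) show "coeff (rising_poly (Suc j)) (Suc j) = (1 / \<alpha>) ^ Suc j"
    by (simp add: eq coeff_pCons mult.commute[of "rising_poly j"])
qed (simp_all add: rising_poly_def)

definition eigen_poly :: "nat \<Rightarrow> real poly" where
  "eigen_poly k = (\<Sum>j\<le>k. smult (fact k * p ^ j * (egf C ^ j) $ k / fact j) (rising_poly j))"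

lemma poly_eigen_poly: "poly (eigen_poly k) w = eigen k w"
  by (simp add: eigen_poly_def eigen_def weight_fps_nth poly_sum poly_rising_poly sum_distrib_left mult_ac)

lemma eigen_poly_degree: "degree (eigen_poly k) \<le> k"
  unfolding eigen_poly_def using rising_poly_degree(1) order_trans degree_smult_le
  by (intro degree_sum_le) (auto intro: order_trans[OF degree_smult_le] order_trans)

text \<open>
  Only the summand \<open>j = k\<close> reaches degree \<open>k\<close>, and the \<open>k\<close>-th coefficient of \<open>K ^ k\<close> is \<open>C 1 ^ k\<close>. This
  is where the value of \<open>C 1\<close> matters: it makes the moments of the weight, multiplied by
  \<open>p / (p + \<alpha>)\<close>, come out without a further constant.
\<close>

lemma eigen_poly_top: "coeff (eigen_poly k) k = (p / (p + \<alpha>)) ^ k"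
proof -
  have "coeff (eigen_poly k) k = (\<Sum>j\<le>k. if j = k then fact k * p ^ k * (egf C ^ k) $ k / fact k * (1 / \<alpha>) ^ k else 0)"
    unfolding eigen_poly_def coeff_sum
  proof (intro sum.cong refl)
    fix j assume "j \<in> {..k}"
    then show "coeff (smult (fact k * p ^ j * (egf C ^ j) $ k / fact j) (rising_poly j)) k =
      (if j = k then fact k * p ^ k * (egf C ^ k) $ k / fact k * (1 / \<alpha>) ^ k else 0)"
      using rising_poly_degree[of j] coeff_eq_0[of "rising_poly j" k] by auto
  qed
  also have "\<dots> = (p / (p + \<alpha>)) ^ k"
    using \<alpha> p C_1 by (simp add: startsby_zero_power_nth_same egf_nth power_divide power_mult_distrib)
  finally show ?thesis .
qed

section \<open>Growth of the coefficients\<close>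

lemma C_nonneg: "C k \<ge> 0" if "k \<ge> 1"
  using that
proof (induction k rule: less_induct)
  case (less k)
  show ?case
  proof (cases "k \<ge> 2")
    case False
    with less have "k = 1" by simp
    then show ?thesis using \<alpha> p C_1 by simp
  next
    case True
    have "partial_bell k j C \<ge> 0" if "j \<in> {2..k}" for j
      unfolding partial_bell_def using that less.IH
      by (intro sum_nonneg mult_nonneg_nonneg prod_nonneg ballI divide_nonneg_nonneg zero_le_power) auto
    moreover have "p ^ j * Gamma (1 / \<alpha> + real j) / Gamma (1 / \<alpha>) \<ge> 0" for j
      using \<alpha> p by (intro divide_nonneg_nonneg mult_nonneg_nonneg zero_le_power less_imp_le[OF Gamma_real_pos])
        (auto simp: add_pos_nonneg)
    ultimately have "(real k - 1) * (p / \<alpha> + 1) * C k \<ge> 0"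
      unfolding C_rec[OF True] by (intro sum_nonneg mult_nonneg_nonneg) auto
    moreover have "(real k - 1) * (p / \<alpha> + 1) > 0"
      using True \<alpha> p by (intro mult_pos_pos) (auto simp: add_nonneg_pos)
    ultimately show ?thesis
      by (simp add: zero_le_mult_iff)
  qed
qed

lemma egf_C_nonneg: "egf C $ k \<ge> 0"
  using C_nonneg[of k] by (simp add: egf_nth)

lemma rising_coeff_bound: "pochhammer (1 / \<alpha>) j / fact j * p ^ j \<le> max 1 (1 / \<alpha>) ^ j"
proof (induction j)
  case (Suc j)
  have "pochhammer (1 / \<alpha>) (Suc j) / fact (Suc j) * p ^ Suc j =
    (pochhammer (1 / \<alpha>) j / fact j * p ^ j) * ((1 / \<alpha> + real j) / (1 + real j) * p)"
    by (simp add: pochhammer_Suc field_simps)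
  also have "\<dots> \<le> max 1 (1 / \<alpha>) ^ j * max 1 (1 / \<alpha>)"
  proof (intro mult_mono Suc.IH)
    have "(1 / \<alpha> + real j) \<le> max 1 (1 / \<alpha>) * (1 + real j)"
    proof -
      have "max 1 (1 / \<alpha>) * real j \<ge> 1 * real j"
        by (intro mult_right_mono) auto
      then show ?thesis by (simp add: distrib_left)
    qed
    then have "(1 / \<alpha> + real j) / (1 + real j) \<le> max 1 (1 / \<alpha>)"
      by (simp add: pos_divide_le_eq)
    then have "(1 / \<alpha> + real j) / (1 + real j) * p \<le> max 1 (1 / \<alpha>) * 1"
      using p \<alpha> by (intro mult_mono) auto
    then show "(1 / \<alpha> + real j) / (1 + real j) * p \<le> max 1 (1 / \<alpha>)" by simp
  qed (use p \<alpha> in auto)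
  finally show ?case by (simp add: mult.commute)
qed simp

text \<open>
  Since \<open>k - 1 \<ge> 1\<close>, the recursion bounds the \<open>k\<close>-th coefficient of \<open>K\<close> by that of \<open>\<Sum>\<^sub>j\<^sub>\<ge>\<^sub>2 (D K) ^ j\<close>, where \<open>D\<close>
  dominates the ratios of consecutive coefficients of \<open>(1 - p X) ^ (- 1 / \<alpha>)\<close>. A function bounded by \<open>R\<close> is thus
  mapped to one of size about \<open>(D R)\<^sup>2\<close>, which is below \<open>R / 2\<close> for small \<open>R\<close>; evaluated at a small
  radius \<open>r\<close>, all partial sums of \<open>K\<close> stay below \<open>R\<close>.
\<close>

lemma egf_C_exponential_bound: "\<exists>A B. \<forall>k. egf C $ k \<le> A * B ^ k"
proof -
  \<comment> \<open>The choice of \<open>R\<close> gives \<open>D * R \<le> 1 / 4\<close> and \<open>(D * R)\<^sup>2 / (1 / 2) = R / 2\<close>; the other half of \<open>R\<close> is for \<open>C 1 * r\<close>.\<close>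
  define D where "D = max 1 (1 / \<alpha>)"
  define R where "R = 1 / (4 * D ^ 2)"
  define r where "r = R / 2"
  have D: "D \<ge> 1" by (simp add: D_def)
  then have "D \<le> D ^ 2" "D > 0" by (simp_all add: power2_eq_square)
  then have R: "R > 0" "D * R \<le> 1 / 4"
    by (simp_all add: R_def field_simps power2_eq_square)
  have r: "r > 0" using R by (simp add: r_def)
  have S: "partial_sum r N (egf C) \<le> R" for N
  proof (induction N)
    case 0
    then show ?case using R by (simp add: partial_sum_def egf_nth)
  next
    case (Suc N)
    have powers: "partial_sum r (Suc N) (egf C ^ j) \<le> R ^ j" if "j \<ge> 2" for j
    proof -
      have "partial_sum r (Suc N) (egf C ^ j) \<le> partial_sum r N (egf C) ^ j"
        using that r by (intro partial_sum_power egf_C_nonneg) (auto simp: egf_nth)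
      also have "\<dots> \<le> R ^ j"
        using Suc r egf_C_nonneg by (intro power_mono) (auto simp: partial_sum_def intro!: sum_nonneg)
      finally show ?thesis .
    qed
    have coeff: "egf C $ k \<le> (\<Sum>j=2..Suc N. D ^ j * (egf C ^ j) $ k)" if k: "k \<in> {2..Suc N}" for k
    proof -
      have "egf C $ k * 1 \<le> egf C $ k * ((real k - 1) * (p / \<alpha> + 1))"
      proof (intro mult_left_mono egf_C_nonneg)
        have "1 * 1 \<le> (real k - 1) * (p / \<alpha> + 1)"
          using k \<alpha> p by (intro mult_mono) auto
        then show "1 \<le> (real k - 1) * (p / \<alpha> + 1)" by simp
      qed
      also have "\<dots> = (\<Sum>j=2..k. pochhammer (1 / \<alpha>) j / fact j * p ^ j * (egf C ^ j) $ k)"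
        using C_rec_coeff[of k] k by (simp add: egf_nth)
      also have "\<dots> \<le> (\<Sum>j=2..k. D ^ j * (egf C ^ j) $ k)"
        unfolding D_def
        by (intro sum_mono mult_right_mono rising_coeff_bound fps_power_nth_nonneg egf_C_nonneg)
      also have "\<dots> \<le> (\<Sum>j=2..Suc N. D ^ j * (egf C ^ j) $ k)"
        using k D by (intro sum_mono2 mult_nonneg_nonneg fps_power_nth_nonneg egf_C_nonneg) auto
      finally show ?thesis by simp
    qed
    have "partial_sum r (Suc N) (egf C) = (\<Sum>k\<in>{..Suc N}. egf C $ k * r ^ k)"
      by (simp add: partial_sum_def)
    also have "\<dots> \<le> (\<Sum>k\<in>{0, 1} \<union> {2..Suc N}. egf C $ k * r ^ k)"
      using r by (intro sum_mono2 mult_nonneg_nonneg egf_C_nonneg) auto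
    also have "\<dots> = C 1 * r + (\<Sum>k=2..Suc N. egf C $ k * r ^ k)"
      by (subst sum.union_disjoint) (auto simp: egf_nth)
    also have "C 1 * r \<le> 1 * r"
      using \<alpha> p r C_1 by (intro mult_right_mono) auto
    also have "(\<Sum>k=2..Suc N. egf C $ k * r ^ k) \<le>
      (\<Sum>k=2..Suc N. (\<Sum>j=2..Suc N. D ^ j * (egf C ^ j) $ k) * r ^ k)"
      using r by (intro sum_mono mult_right_mono coeff) auto
    also have "\<dots> = (\<Sum>j=2..Suc N. D ^ j * (\<Sum>k=2..Suc N. (egf C ^ j) $ k * r ^ k))"
      unfolding sum_distrib_left sum_distrib_right
      by (subst sum.swap) (simp add: mult.assoc)
    also have "\<dots> \<le> (\<Sum>j=2..Suc N. D ^ j * partial_sum r (Suc N) (egf C ^ j))"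
      unfolding partial_sum_def using r D
      by (intro sum_mono mult_left_mono sum_mono2 mult_nonneg_nonneg fps_power_nth_nonneg egf_C_nonneg) auto
    also have "\<dots> \<le> (\<Sum>j=2..Suc N. (D * R) ^ j)"
      unfolding power_mult_distrib using D by (intro sum_mono mult_left_mono powers) auto
    also have "\<dots> \<le> (D * R) ^ 2 / (1 - D * R)"
      using R D by (intro geometric_tail_le) auto
    also have "\<dots> \<le> (D * R) ^ 2 / (1 / 2)"
      using R by (intro divide_left_mono) auto
    also have "\<dots> = R / 2"
      using D by (simp add: R_def power2_eq_square)
    finally show ?case by (simp add: r_def)
  qed
  have "egf C $ k \<le> R * (1 / r) ^ k" for k
  proof -
    have "egf C $ k * r ^ k \<le> partial_sum r k (egf C)"
      unfolding partial_sum_def using r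
      by (intro member_le_sum[of k "{..k}" "\<lambda>k. egf C $ k * r ^ k"]) (auto intro: mult_nonneg_nonneg egf_C_nonneg)
    also note S
    finally show ?thesis using r by (simp add: field_simps power_one_over)
  qed
  then show ?thesis by blast
qed

end

text \<open>
  Monotonicity of the Gamma function reduces the claim to factorials: with \<open>x = k \<beta> - c\<close> and
  \<open>E = (B + 1) ^ (1 / \<beta>)\<close>, the numerator is at most \<open>E\<close> to the power \<open>x + c\<close>.
\<close>

lemma power_over_Gamma_tendsto_0:
  fixes B \<beta> c :: real
  assumes \<beta>: "\<beta> > 0" and B: "B \<ge> 0"
  shows "(\<lambda>k. B ^ k / Gamma (real k * \<beta> - c)) \<longlonglongrightarrow> 0"
proof -
  define E where "E = (B + 1) powr (1 / \<beta>)"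
  define n where "n k = nat \<lfloor>real k * \<beta> - c\<rfloor>" for k
  have E: "E \<ge> 1"
    using B \<beta> by (simp add: E_def ge_one_powr_ge_zero)
  have top: "filterlim (\<lambda>k. real k * \<beta> - c) at_top sequentially"
    using \<beta> by real_asymp
  have "filterlim (\<lambda>k. n k - 1) at_top sequentially"
    unfolding n_def using \<beta> by real_asymp
  moreover have "(\<lambda>n. E ^ n / fact n) \<longlonglongrightarrow> 0"
    using summable_LIMSEQ_zero[OF summable_exp[of E]] by (simp add: divide_inverse mult.commute)
  ultimately have "(\<lambda>k. E ^ (n k - 1) / fact (n k - 1)) \<longlonglongrightarrow> 0"
    by (rule filterlim_compose[rotated])
  then have lim: "(\<lambda>k. E powr (c + 2) * (E ^ (n k - 1) / fact (n k - 1))) \<longlonglongrightarrow> 0"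
    by (rule tendsto_mult_right_zero)
  have "eventually (\<lambda>k. norm (B ^ k / Gamma (real k * \<beta> - c)) \<le>
      E powr (c + 2) * (E ^ (n k - 1) / fact (n k - 1))) sequentially"
    using filterlim_at_top_dense[THEN iffD1, OF top, rule_format, of 3]
  proof eventually_elim
    case (elim k)
    define x where "x = real k * \<beta> - c"
    have n: "real (n k) \<le> x" "x < real (n k) + 1" "n k \<ge> 3"
      using elim by (auto simp: n_def x_def le_nat_floor)
    have "Gamma (real (n k)) \<le> Gamma x"
      using n Gamma_real_strict_mono[of "real (n k)" x] by (cases "real (n k) = x") auto
    moreover have "Gamma (real (n k)) = fact (n k - 1)"
      using n(3) by (simp add: Gamma_fact[symmetric] of_nat_diff)
    ultimately have G: "fact (n k - 1) \<le> Gamma x" by simp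
    have "B ^ k \<le> (B + 1) ^ k"
      using B by (intro power_mono) auto
    also have "(B + 1) ^ k = E powr (x + c)"
      using B \<beta> by (simp add: E_def powr_powr x_def powr_realpow)
    also have "\<dots> \<le> E powr (c + 2 + real (n k - 1))"
      using n E by (intro powr_mono) (auto simp: of_nat_diff)
    also have "\<dots> = E powr (c + 2) * E ^ (n k - 1)"
      using E by (simp add: powr_add powr_realpow)
    finally have "B ^ k / Gamma x \<le> E powr (c + 2) * E ^ (n k - 1) / fact (n k - 1)"
      using G B E by (intro frac_le) auto
    moreover have "Gamma x > 0"
      using elim by (intro Gamma_real_pos) (simp add: x_def)
    ultimately show ?case
      using B by (simp add: x_def)
  qed
  then show ?thesis
    using lim by (rule Lim_null_comparison)
qed

section \<open>The Markov chain of cluster size and weight\<close>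

text \<open>
  The total weight of a tree with \<open>i + 1\<close> vertices, hence with \<open>i\<close> arcs. Here and below the time \<open>i\<close>
  is the number of vertices that have been added to the root.
\<close>

definition tree_weight :: "real \<Rightarrow> nat \<Rightarrow> real" where
  "tree_weight \<alpha> i = (1 + \<alpha>) * i + 1"

definition cluster_step :: "real \<Rightarrow> real \<Rightarrow> nat \<Rightarrow> nat \<times> real \<Rightarrow> (nat \<times> real) pmf" where
  "cluster_step \<alpha> p i = (\<lambda>(m, w). do {
     hit \<leftarrow> bernoulli_pmf (w / tree_weight \<alpha> i);
     same \<leftarrow> bernoulli_pmf p;
     return_pmf (if hit then if same then (Suc m, w + (\<alpha> + 1)) else (m, w + \<alpha>) else (m, w))
   })"

primrec cluster_chain :: "real \<Rightarrow> real \<Rightarrow> nat \<Rightarrow> (nat \<times> real) pmf" where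
  "cluster_chain \<alpha> p 0 = return_pmf (1, 1)"
| "cluster_chain \<alpha> p (Suc i) = cluster_chain \<alpha> p i \<bind> cluster_step \<alpha> p i"

lemma finite_set_cluster_step: "finite (set_pmf (cluster_step \<alpha> p i x))"
  by (auto simp: cluster_step_def set_bind_pmf split: prod.split)

lemma finite_set_cluster_chain: "finite (set_pmf (cluster_chain \<alpha> p i))"
  by (induction i) (auto simp: set_bind_pmf finite_set_cluster_step)

lemma tree_weight_pos: "\<alpha> > 0 \<Longrightarrow> tree_weight \<alpha> i > 0"
  by (simp add: tree_weight_def add_nonneg_pos)

lemma cluster_chain_weight_bounds:
  assumes "\<alpha> > 0" "x \<in> set_pmf (cluster_chain \<alpha> p i)"
  shows "snd x \<in> {0..tree_weight \<alpha> i}"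
  using assms(2)
proof (induction i arbitrary: x)
  case 0
  then show ?case by (simp add: tree_weight_def)
next
  case (Suc i)
  then obtain y where y: "y \<in> set_pmf (cluster_chain \<alpha> p i)" "x \<in> set_pmf (cluster_step \<alpha> p i y)"
    by (auto simp: set_bind_pmf)
  have "snd y \<in> {0..tree_weight \<alpha> i}"
    by (rule Suc.IH[OF y(1)])
  moreover have "snd x \<in> {snd y, snd y + \<alpha>, snd y + (\<alpha> + 1)}"
    using y(2) by (auto simp: cluster_step_def set_bind_pmf split: prod.splits if_splits)
  moreover have "tree_weight \<alpha> (Suc i) = tree_weight \<alpha> i + (\<alpha> + 1)"
    by (simp add: tree_weight_def algebra_simps)
  ultimately show ?case
    using assms(1) by auto
qed

abbreviation chain_expectation :: "real \<Rightarrow> real \<Rightarrow> nat \<Rightarrow> (nat \<times> real \<Rightarrow> real) \<Rightarrow> real" where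
  "chain_expectation \<alpha> p i \<equiv> measure_pmf.expectation (cluster_chain \<alpha> p i)"

lemma integrable_cluster_chain [simp]:
  fixes f :: "nat \<times> real \<Rightarrow> real"
  shows "integrable (measure_pmf (cluster_chain \<alpha> p i)) f"
  by (rule integrable_measure_pmf_finite[OF finite_set_cluster_chain])

lemma expectation_bernoulli_bind:
  fixes h :: "'a \<Rightarrow> real"
  assumes "0 \<le> q" "q \<le> 1" "\<And>b. finite (set_pmf (f b))"
  shows "measure_pmf.expectation (bernoulli_pmf q \<bind> f) h =
    q * measure_pmf.expectation (f True) h + (1 - q) * measure_pmf.expectation (f False) h"
proof -
  have "measure_pmf.expectation (bernoulli_pmf q \<bind> f) h =
    (\<Sum>b\<in>UNIV. pmf (bernoulli_pmf q) b *\<^sub>R measure_pmf.expectation (f b) h)"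
    using assms(3) by (intro pmf_expectation_bind) auto
  then show ?thesis
    using assms(1,2) by (simp add: UNIV_bool)
qed

lemma chain_expectation_Suc:
  assumes \<alpha>: "\<alpha> > 0" and p: "0 \<le> p" "p \<le> 1"
  shows "chain_expectation \<alpha> p (Suc i) f = chain_expectation \<alpha> p i
    (\<lambda>(m, w). f (m, w) + w / tree_weight \<alpha> i *
      (p * f (Suc m, w + (\<alpha> + 1)) + (1 - p) * f (m, w + \<alpha>) - f (m, w)))"
proof -
  let ?A = "set_pmf (cluster_chain \<alpha> p i)"
  let ?g = "\<lambda>(m, w). f (m, w) + w / tree_weight \<alpha> i *
      (p * f (Suc m, w + (\<alpha> + 1)) + (1 - p) * f (m, w + \<alpha>) - f (m, w))"
  have step: "measure_pmf.expectation (cluster_step \<alpha> p i x) f = ?g x" if "x \<in> ?A" for x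
  proof -
    obtain m w where x: "x = (m, w)" by (cases x)
    have "w / tree_weight \<alpha> i \<in> {0..1}"
      using cluster_chain_weight_bounds[OF \<alpha> that] tree_weight_pos[OF \<alpha>, of i] by (simp add: x)
    then show ?thesis
      using p by (simp add: x cluster_step_def expectation_bernoulli_bind set_bind_pmf algebra_simps)
  qed
  have "chain_expectation \<alpha> p (Suc i) f =
    (\<Sum>x\<in>?A. pmf (cluster_chain \<alpha> p i) x *\<^sub>R measure_pmf.expectation (cluster_step \<alpha> p i x) f)"
    unfolding cluster_chain.simps
    by (intro pmf_expectation_bind finite_set_cluster_chain finite_set_cluster_step) auto
  also have "\<dots> = (\<Sum>x\<in>?A. pmf (cluster_chain \<alpha> p i) x *\<^sub>R ?g x)"
    by (intro sum.cong refl) (simp add: step)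
  also have "\<dots> = chain_expectation \<alpha> p i ?g"
    by (rule integral_measure_pmf[symmetric]) (auto simp: finite_set_cluster_chain)
  finally show ?thesis .
qed

text \<open>
  One step multiplies the mean of an eigenfunction by \<open>1 + \<theta> / tree_weight \<alpha> i\<close>, and these factors are
  quotients of the factors of two rising factorials.
\<close>

lemma chain_expectation_eigenfunction:
  assumes \<alpha>: "\<alpha> > 0" and p: "0 \<le> p" "p \<le> 1"
    and eigen: "\<And>w. w * (p * g (w + (\<alpha> + 1)) + (1 - p) * g (w + \<alpha>) - g w) = \<theta> * g w"
  shows "chain_expectation \<alpha> p i (\<lambda>(m, w). g w) =
    g 1 * (pochhammer (1 / (1 + \<alpha>) + \<theta> / (1 + \<alpha>)) i / pochhammer (1 / (1 + \<alpha>)) i)"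
proof (induction i)
  case 0
  then show ?case by simp
next
  case (Suc i)
  have T: "tree_weight \<alpha> i > 0" by (rule tree_weight_pos[OF \<alpha>])
  have factor: "1 + \<theta> / tree_weight \<alpha> i =
    (1 / (1 + \<alpha>) + \<theta> / (1 + \<alpha>) + i) / (1 / (1 + \<alpha>) + i)"
  proof -
    have eq: "1 / (1 + \<alpha>) + \<theta> / (1 + \<alpha>) + i = (tree_weight \<alpha> i + \<theta>) / (1 + \<alpha>)"
      "1 / (1 + \<alpha>) + i = tree_weight \<alpha> i / (1 + \<alpha>)"
      using \<alpha> by (simp_all add: tree_weight_def add_divide_distrib[symmetric] field_simps)
    have "(tree_weight \<alpha> i + \<theta>) / (1 + \<alpha>) / (tree_weight \<alpha> i / (1 + \<alpha>)) =
        (tree_weight \<alpha> i + \<theta>) / tree_weight \<alpha> i"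
      using \<alpha> by simp
    also have "\<dots> = 1 + \<theta> / tree_weight \<alpha> i"
      using T by (simp add: add_divide_distrib)
    finally show ?thesis
      unfolding eq by simp
  qed
  have "chain_expectation \<alpha> p (Suc i) (\<lambda>(m, w). g w) =
    chain_expectation \<alpha> p i (\<lambda>(m, w). g w * (1 + \<theta> / tree_weight \<alpha> i))"
    unfolding chain_expectation_Suc[OF \<alpha> p]
  proof (intro arg_cong[where f = "chain_expectation \<alpha> p i"] ext, clarify)
    fix w
    show "g w + w / tree_weight \<alpha> i * (p * g (w + (\<alpha> + 1)) + (1 - p) * g (w + \<alpha>) - g w) =
      g w * (1 + \<theta> / tree_weight \<alpha> i)"
      using eigen[of w] by (simp add: algebra_simps flip: add_divide_distrib diff_divide_distrib)
  qed
  also have "\<dots> = chain_expectation \<alpha> p i (\<lambda>(m, w). g w) * (1 + \<theta> / tree_weight \<alpha> i)"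
    by (simp add: case_prod_unfold)
  finally show ?case
    by (simp add: Suc.IH factor pochhammer_Suc)
qed

lemma chain_expectation_weight:
  assumes "\<alpha> > 0" "0 \<le> p" "p \<le> 1"
  shows "chain_expectation \<alpha> p i (\<lambda>(m, w). w) =
    pochhammer (1 / (1 + \<alpha>) + (p + \<alpha>) / (1 + \<alpha>)) i / pochhammer (1 / (1 + \<alpha>)) i"
  using chain_expectation_eigenfunction[OF assms, of "\<lambda>w. w" "p + \<alpha>" i]
  by (simp add: algebra_simps)

text \<open>
  The increments of \<open>(p + \<alpha>) m - p w\<close> at an attachment to the cluster are \<open>\<alpha> (1 - p)\<close> and \<open>- p \<alpha>\<close>
  with probabilities \<open>p\<close> and \<open>1 - p\<close>: they have mean \<open>0\<close> and variance \<open>\<alpha>\<^sup>2 p (1 - p)\<close>. The weight grows by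
  \<open>p + \<alpha>\<close> on average at the same events, so second moment and mean weight grow proportionally.
\<close>

lemma chain_expectation_discrepancy_sq:
  assumes \<alpha>: "\<alpha> > 0" and p: "0 \<le> p" "p \<le> 1"
  shows "chain_expectation \<alpha> p i (\<lambda>(m, w). ((p + \<alpha>) * m - p * w) ^ 2) =
    \<alpha> ^ 2 + \<alpha> ^ 2 * p * (1 - p) / (p + \<alpha>) * (chain_expectation \<alpha> p i (\<lambda>(m, w). w) - 1)"
proof (induction i)
  case 0
  then show ?case by simp
next
  case (Suc i)
  have pa: "p + \<alpha> > 0" using \<alpha> p by simp
  have "chain_expectation \<alpha> p (Suc i) (\<lambda>(m, w). ((p + \<alpha>) * m - p * w) ^ 2) =
    chain_expectation \<alpha> p i (\<lambda>(m, w). ((p + \<alpha>) * m - p * w) ^ 2 +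
      \<alpha> ^ 2 * p * (1 - p) / tree_weight \<alpha> i * w)"
    unfolding chain_expectation_Suc[OF \<alpha> p]
  proof (intro arg_cong[where f = "chain_expectation \<alpha> p i"] ext, clarify)
    fix m :: nat and w
    have "p * ((p + \<alpha>) * real (Suc m) - p * (w + (\<alpha> + 1))) ^ 2 + (1 - p) * ((p + \<alpha>) * m - p * (w + \<alpha>)) ^ 2 -
      ((p + \<alpha>) * m - p * w) ^ 2 = \<alpha> ^ 2 * p * (1 - p)"
      by (simp add: power2_eq_square algebra_simps)
    then show "((p + \<alpha>) * m - p * w) ^ 2 + w / tree_weight \<alpha> i *
        (p * ((p + \<alpha>) * real (Suc m) - p * (w + (\<alpha> + 1))) ^ 2 + (1 - p) * ((p + \<alpha>) * m - p * (w + \<alpha>)) ^ 2 -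
      ((p + \<alpha>) * m - p * w) ^ 2) = ((p + \<alpha>) * m - p * w) ^ 2 + \<alpha> ^ 2 * p * (1 - p) / tree_weight \<alpha> i * w"
      by simp
  qed
  moreover have "chain_expectation \<alpha> p (Suc i) (\<lambda>(m, w). w) =
    chain_expectation \<alpha> p i (\<lambda>(m, w). w) + (p + \<alpha>) / tree_weight \<alpha> i * chain_expectation \<alpha> p i (\<lambda>(m, w). w)"
  proof -
    have "chain_expectation \<alpha> p (Suc i) (\<lambda>(m, w). w) =
      chain_expectation \<alpha> p i (\<lambda>(m, w). w + (p + \<alpha>) / tree_weight \<alpha> i * w)"
      unfolding chain_expectation_Suc[OF \<alpha> p]
      by (intro arg_cong[where f = "chain_expectation \<alpha> p i"] ext) (auto simp: algebra_simps add_divide_distrib diff_divide_distrib)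
    then show ?thesis by (simp add: case_prod_unfold)
  qed
  ultimately show ?case
    using Suc.IH pa by (simp add: case_prod_unfold) (simp add: field_simps)
qed

text \<open>A quotient of two instances of Euler's product formula for the Gamma function.\<close>

lemma pochhammer_ratio_limit:
  fixes s x :: real
  assumes s: "s > 0" and x: "x \<ge> 0"
  shows "(\<lambda>i. pochhammer (s + x) i / pochhammer s i / real (Suc i) powr x) \<longlonglongrightarrow> Gamma s / Gamma (s + x)"
proof (rule LIMSEQ_offset[where k = 1])
  have "Gamma (s + x) > 0"
    by (intro Gamma_real_pos) (use s x in linarith)
  then have "(\<lambda>n. Gamma_series s n / Gamma_series (s + x) n) \<longlonglongrightarrow> Gamma s / Gamma (s + x)"
    by (intro tendsto_intros) auto
  moreover have "(\<lambda>n. real n powr x / real (n + 2) powr x) \<longlonglongrightarrow> 1"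
    by real_asymp
  ultimately have "(\<lambda>n. Gamma_series s n / Gamma_series (s + x) n * (real n powr x / real (n + 2) powr x))
      \<longlonglongrightarrow> Gamma s / Gamma (s + x) * 1"
    by (rule tendsto_mult)
  moreover have "eventually (\<lambda>n. Gamma_series s n / Gamma_series (s + x) n * (real n powr x / real (n + 2) powr x) =
    pochhammer (s + x) (n + 1) / pochhammer s (n + 1) / real (Suc (n + 1)) powr x) sequentially"
    using eventually_gt_at_top[of 0]
  proof eventually_elim
    case (elim n)
    have "exp ((s + x) * ln n) = exp (s * ln n) * real n powr x"
      using elim by (simp add: powr_def distrib_right exp_add)
    then show ?case
      using elim s x pochhammer_pos[of s "n + 1"] pochhammer_pos[of "s + x" "n + 1"]
      by (simp add: Gamma_series_def add.commute del: pochhammer_Suc)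
  qed
  ultimately show "(\<lambda>n. pochhammer (s + x) (n + 1) / pochhammer s (n + 1) / real (Suc (n + 1)) powr x)
      \<longlonglongrightarrow> Gamma s / Gamma (s + x)"
    by (auto elim: Lim_transform_eventually)
qed

section \<open>The scaling limit of the chain\<close>

context cluster_moments
begin

abbreviation \<beta> :: real where "\<beta> \<equiv> (p + \<alpha>) / (1 + \<alpha>)"

abbreviation \<sigma> :: real where "\<sigma> \<equiv> 1 / (1 + \<alpha>)"

definition limit_moment :: "nat \<Rightarrow> real" where
  "limit_moment k = eigen k 1 * (Gamma \<sigma> / Gamma (\<sigma> + k * \<beta>))"

definition norming :: "nat \<Rightarrow> real" where
  "norming i = real (Suc i) powr \<beta>"

lemma \<beta>_pos: "\<beta> > 0"
  using \<alpha> p by (intro divide_pos_pos) auto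

lemma norming_pos: "norming i > 0"
  by (simp add: norming_def)

lemma norming_at_top: "filterlim norming at_top sequentially"
proof -
  have "filterlim (\<lambda>i. real (Suc i) powr b) at_top sequentially" if "b > 0" for b :: real
    using that by real_asymp
  from this[OF \<beta>_pos] show ?thesis by (simp add: norming_def[abs_def])
qed

lemma norming_power: "norming i ^ k = real (Suc i) powr (k * \<beta>)"
  by (simp add: norming_def powr_powr mult.commute flip: powr_realpow)

lemma expectation_eigen_limit:
  "(\<lambda>i. chain_expectation \<alpha> p i (\<lambda>(m, w). eigen k w) / norming i ^ k) \<longlonglongrightarrow> limit_moment k"
proof -
  have "(\<lambda>i. eigen k 1 * (pochhammer (\<sigma> + k * \<beta>) i / pochhammer \<sigma> i / real (Suc i) powr (k * \<beta>))) \<longlonglongrightarrow> limit_moment k"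
    unfolding limit_moment_def using \<alpha> p
    by (intro tendsto_mult_left pochhammer_ratio_limit) auto
  moreover have "chain_expectation \<alpha> p i (\<lambda>(m, w). eigen k w) =
      eigen k 1 * (pochhammer (\<sigma> + k * \<beta>) i / pochhammer \<sigma> i)" for i
    using chain_expectation_eigenfunction[OF \<alpha> p, of "eigen k" "k * (p + \<alpha>)" i] eigen_generator by simp
  ultimately show ?thesis
    by (simp add: norming_power)
qed

lemma expectation_weight_limit:
  "(\<lambda>i. chain_expectation \<alpha> p i (\<lambda>(m, w). w) / norming i) \<longlonglongrightarrow> Gamma \<sigma> / Gamma (\<sigma> + \<beta>)"
  using pochhammer_ratio_limit[of \<sigma> \<beta>] \<alpha> \<beta>_pos
  by (simp add: chain_expectation_weight[OF \<alpha> p] norming_def)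

text \<open>
  The eigenpolynomial of degree \<open>k\<close> differs from \<open>(p / (p + \<alpha>)) ^ k * w ^ k\<close> by lower powers of \<open>w\<close>,
  whose means are of smaller order by induction. For \<open>p = 0\<close> the leading coefficient vanishes.
\<close>

lemma expectation_weight_power_limit:
  assumes "p > 0"
  shows "(\<lambda>i. chain_expectation \<alpha> p i (\<lambda>(m, w). w ^ k) / norming i ^ k) \<longlonglongrightarrow> limit_moment k / (p / (p + \<alpha>)) ^ k"
proof (induction k rule: less_induct)
  case (less k)
  let ?E = "\<lambda>j i. chain_expectation \<alpha> p i (\<lambda>(m, w). w ^ j)"
  let ?c = "p / (p + \<alpha>)"
  have c: "?c > 0" using assms \<alpha> by simp
  have expand: "chain_expectation \<alpha> p i (\<lambda>(m, w). eigen k w) = (\<Sum>j\<le>k. coeff (eigen_poly k) j * ?E j i)" for i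
  proof -
    have "eigen k w = (\<Sum>j\<le>k. coeff (eigen_poly k) j * w ^ j)" for w
      unfolding poly_eigen_poly[symmetric] poly_altdef using eigen_poly_degree[of k]
      by (intro sum.mono_neutral_left) (auto simp: coeff_eq_0)
    then show ?thesis
      by (simp add: case_prod_unfold)
  qed
  have lower: "(\<lambda>i. coeff (eigen_poly k) j * (?E j i / norming i ^ k)) \<longlonglongrightarrow> 0" if "j < k" for j
  proof -
    have "filterlim (\<lambda>i. norming i ^ (k - j)) at_top sequentially"
      using that by (intro filterlim_pow_at_top norming_at_top) auto
    with less.IH[OF that] have "(\<lambda>i. (?E j i / norming i ^ j) / norming i ^ (k - j)) \<longlonglongrightarrow> 0"
      by (rule tendsto_divide_0[OF _ filterlim_at_top_imp_at_infinity])
    moreover have "(?E j i / norming i ^ j) / norming i ^ (k - j) = ?E j i / norming i ^ k" for i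
      using that by (simp flip: power_add)
    ultimately have "(\<lambda>i. ?E j i / norming i ^ k) \<longlonglongrightarrow> 0"
      by (simp only:)
    then show ?thesis
      by (rule tendsto_mult_right_zero)
  qed
  have "(\<lambda>i. chain_expectation \<alpha> p i (\<lambda>(m, w). eigen k w) / norming i ^ k -
      (\<Sum>j<k. coeff (eigen_poly k) j * (?E j i / norming i ^ k))) \<longlonglongrightarrow> limit_moment k - (\<Sum>j<k. 0)"
    by (intro tendsto_diff tendsto_sum expectation_eigen_limit lower) auto
  moreover have "chain_expectation \<alpha> p i (\<lambda>(m, w). eigen k w) / norming i ^ k -
      (\<Sum>j<k. coeff (eigen_poly k) j * (?E j i / norming i ^ k)) = ?c ^ k * (?E k i / norming i ^ k)" for i
    by (simp add: expand eigen_poly_top lessThan_Suc_atMost[symmetric] add_divide_distrib sum_divide_distrib)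
  ultimately have "(\<lambda>i. ?c ^ k * (?E k i / norming i ^ k) / ?c ^ k) \<longlonglongrightarrow> limit_moment k / ?c ^ k"
    using c by (intro tendsto_divide) auto
  moreover have "?c ^ k \<noteq> 0" using zero_less_power[OF c, of k] by (simp only: less_imp_neq[symmetric] not_False_eq_True)
  ultimately show ?case by (simp only: nonzero_mult_div_cancel_left not_False_eq_True)
qed

lemma limit_moment_0: "limit_moment 0 = 1"
proof -
  have "Gamma \<sigma> > 0"
    by (intro Gamma_real_pos) (use \<alpha> in simp)
  then show ?thesis by (simp add: limit_moment_def eigen_def weight_fps_nth)
qed

lemma limit_moment_p_0:
  assumes "p = 0" "k \<ge> 1"
  shows "limit_moment k = 0"
proof -
  have "weight_fps 1 $ k = (\<Sum>j\<le>k. 0)"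
    unfolding weight_fps_nth using assms by (intro sum.cong) (auto simp: power_0_left)
  then show ?thesis by (simp add: limit_moment_def eigen_def)
qed

lemma scaled_weight_moment_limit:
  "(\<lambda>i. chain_expectation \<alpha> p i (\<lambda>(m, w). (p / (p + \<alpha>) * w / norming i) ^ k)) \<longlonglongrightarrow> limit_moment k"
proof (cases "p > 0")
  case True
  let ?c = "p / (p + \<alpha>)"
  have c: "?c ^ k \<noteq> 0" using True \<alpha> by simp
  have "(\<lambda>i. ?c ^ k * (chain_expectation \<alpha> p i (\<lambda>(m, w). w ^ k) / norming i ^ k)) \<longlonglongrightarrow>
      ?c ^ k * (limit_moment k / ?c ^ k)"
    by (intro tendsto_mult_left expectation_weight_power_limit True)
  moreover have "chain_expectation \<alpha> p i (\<lambda>(m, w). (?c * w / norming i) ^ k) =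
      ?c ^ k * (chain_expectation \<alpha> p i (\<lambda>(m, w). w ^ k) / norming i ^ k)" for i
  proof -
    have "(?c * w / norming i) ^ k = ?c ^ k / norming i ^ k * w ^ k" for w
      by (simp add: power_mult_distrib power_divide)
    then have "chain_expectation \<alpha> p i (\<lambda>(m, w). (?c * w / norming i) ^ k) =
        chain_expectation \<alpha> p i (\<lambda>x. ?c ^ k / norming i ^ k * snd x ^ k)"
      by (simp add: case_prod_unfold)
    also have "\<dots> = ?c ^ k / norming i ^ k * chain_expectation \<alpha> p i (\<lambda>x. snd x ^ k)"
      by (rule integral_mult_right_zero)
    finally show ?thesis
      by (simp add: case_prod_unfold)
  qed
  moreover have "?c ^ k * (limit_moment k / ?c ^ k) = limit_moment k"
    using c by (simp only: times_divide_eq_right nonzero_mult_div_cancel_left not_False_eq_True)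
  ultimately show ?thesis by simp
next
  case False
  with p have p0: "p = 0" by simp
  then show ?thesis
    using limit_moment_0 limit_moment_p_0[of k] by (cases "k = 0") (auto simp: case_prod_unfold power_0_left)
qed

lemma scaled_discrepancy_tendsto_0:
  "(\<lambda>i. chain_expectation \<alpha> p i (\<lambda>(m, w). \<bar>real m / norming i - p / (p + \<alpha>) * w / norming i\<bar>)) \<longlonglongrightarrow> 0"
proof -
  let ?D = "\<lambda>(m, w). (p + \<alpha>) * real m - p * w"
  define K where "K = \<alpha> ^ 2 * p * (1 - p) / (p + \<alpha>)"
  define L where "L = Gamma \<sigma> / Gamma (\<sigma> + \<beta>)"
  have pa: "p + \<alpha> > 0" using \<alpha> p by simp
  define EW where "EW i = chain_expectation \<alpha> p i (\<lambda>(m, w). w)" for i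
  define ED where "ED i = chain_expectation \<alpha> p i (\<lambda>x. ?D x ^ 2)" for i
  have ED: "ED i = \<alpha> ^ 2 + K * (EW i - 1)" for i
    using chain_expectation_discrepancy_sq[OF \<alpha> p, of i] by (simp add: ED_def EW_def K_def case_prod_unfold)
  have inv: "(\<lambda>i. 1 / norming i) \<longlonglongrightarrow> 0" "(\<lambda>i. 1 / sqrt (norming i)) \<longlonglongrightarrow> 0"
    using norming_at_top
    by (auto intro!: tendsto_divide_0[OF tendsto_const] filterlim_at_top_imp_at_infinity filterlim_compose[OF sqrt_at_top])
  have "(\<lambda>i. (\<alpha> ^ 2 - K) * (1 / norming i) + K * (EW i / norming i)) \<longlonglongrightarrow> (\<alpha> ^ 2 - K) * 0 + K * L"
    unfolding EW_def L_def by (intro tendsto_add tendsto_mult tendsto_const inv expectation_weight_limit)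
  then have "(\<lambda>i. ED i / norming i) \<longlonglongrightarrow> K * L"
    by (simp add: ED algebra_simps add_divide_distrib diff_divide_distrib)
  then have "(\<lambda>i. (ED i / norming i * (1 / sqrt (norming i)) + 1 / sqrt (norming i)) / (2 * (p + \<alpha>))) \<longlonglongrightarrow>
      (K * L * 0 + 0) / (2 * (p + \<alpha>))"
    using pa by (intro tendsto_intros inv) auto
  then have upper: "(\<lambda>i. (ED i / norming i * (1 / sqrt (norming i)) + 1 / sqrt (norming i)) / (2 * (p + \<alpha>))) \<longlonglongrightarrow> 0"
    by simp
  show ?thesis
  proof (rule tendsto_sandwich[OF always_eventually always_eventually tendsto_const upper]; intro allI)
    fix i
    \<comment> \<open>Bounding \<open>2 * \<bar>d\<bar> * a\<close> by \<open>d\<^sup>2 + a\<^sup>2\<close> with \<open>a = sqrt (norming i)\<close> balances the two terms: the mean of \<open>d\<^sup>2\<close> is at most of order \<open>norming i\<close>.\<close>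
    obtain a where a: "a > 0" "norming i = a * a" "sqrt (norming i) = a"
      using norming_pos[of i] by (metis real_sqrt_gt_0_iff real_sqrt_mult_self abs_of_pos)
    show "0 \<le> chain_expectation \<alpha> p i (\<lambda>(m, w). \<bar>real m / norming i - p / (p + \<alpha>) * w / norming i\<bar>)"
      by (intro integral_nonneg_AE AE_pmfI) (auto split: prod.split)
    define S where "S = (p + \<alpha>) * norming i"
    have S: "S > 0" using pa norming_pos[of i] by (simp add: S_def)
    define c where "c = 1 / (2 * S * a)"
    define c' where "c' = a / (2 * S)"
    have bound: "(case x of (m, w) \<Rightarrow> \<bar>real m / norming i - p / (p + \<alpha>) * w / norming i\<bar>) \<le> ?D x ^ 2 * c + c'" for x
    proof -
      obtain m w where x: "x = (m, w)" by (cases x)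
      have "2 * \<bar>?D x\<bar> * a \<le> ?D x ^ 2 + a ^ 2"
        using sum_squares_bound[of "\<bar>?D x\<bar>" a] by simp
      then have "2 * \<bar>?D x\<bar> * a * c \<le> (?D x ^ 2 + a ^ 2) * c"
        using S a(1) by (intro mult_right_mono) (auto simp: c_def)
      moreover have "a ^ 2 * c = c'"
        using a(1) by (simp add: c_def c'_def power2_eq_square)
      moreover have "2 * \<bar>?D x\<bar> * a * c = \<bar>?D x\<bar> / S"
        using a(1) by (simp add: c_def)
      moreover have "real m / norming i - p / (p + \<alpha>) * w / norming i = ?D x / S"
        using pa by (simp add: x S_def diff_divide_distrib)
      then have "\<bar>real m / norming i - p / (p + \<alpha>) * w / norming i\<bar> = \<bar>?D x\<bar> / S"
        using S by simp
      ultimately show ?thesis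
        by (simp add: x distrib_right)
    qed
    have "chain_expectation \<alpha> p i (\<lambda>(m, w). \<bar>real m / norming i - p / (p + \<alpha>) * w / norming i\<bar>) \<le>
      chain_expectation \<alpha> p i (\<lambda>x. ?D x ^ 2 * c + c')"
      by (intro integral_mono integrable_cluster_chain bound)
    also have "\<dots> = ED i * c + c'"
      by (simp add: ED_def)
    also have "\<dots> = (ED i / norming i * (1 / sqrt (norming i)) + 1 / sqrt (norming i)) / (2 * (p + \<alpha>))"
      unfolding a(3) using a(1,2) by (simp add: c_def c'_def S_def add_divide_distrib mult_ac)
    finally show "chain_expectation \<alpha> p i (\<lambda>(m, w). \<bar>real m / norming i - p / (p + \<alpha>) * w / norming i\<bar>) \<le>
      (ED i / norming i * (1 / sqrt (norming i)) + 1 / sqrt (norming i)) / (2 * (p + \<alpha>))" .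
  qed
qed

text \<open>
  By \<open>eigen_1\<close> and \<open>\<Gamma>(z + 1) = z \<Gamma>(z)\<close>. The functional equation fails at \<open>z = 0\<close>, which happens only for
  \<open>p = 0\<close> and \<open>k = 1\<close>; there both sides are \<open>0\<close>, the right-hand side because \<^term>\<open>Gamma (0::real) = 0\<close>.
\<close>

lemma limit_moment_eq:
  assumes "k \<ge> 1"
  shows "limit_moment k = C k * (1 + \<alpha>) * Gamma \<sigma> / (\<alpha> * Gamma ((real k * p + \<alpha> * (real k - 1)) / (\<alpha> + 1)))"
proof -
  define z where "z = (real k * p + \<alpha> * (real k - 1)) / (\<alpha> + 1)"
  have "z + 1 = (real k * p + \<alpha> * (real k - 1) + (\<alpha> + 1)) / (\<alpha> + 1)"
    using \<alpha> by (simp add: z_def add_divide_distrib)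
  also have "\<dots> = (1 + k * (p + \<alpha>)) / (1 + \<alpha>)"
    by (simp add: algebra_simps)
  also have "\<dots> = \<sigma> + k * \<beta>"
    unfolding add_divide_distrib[of 1] by simp
  finally have shift: "\<sigma> + k * \<beta> = z + 1" ..
  have eigen: "\<alpha> * eigen k 1 = z * (1 + \<alpha>) * C k"
    using \<alpha> by (simp add: eigen_1[OF assms] z_def field_simps)
  have "z \<ge> 0"
    using \<alpha> p assms by (simp add: z_def)
  show ?thesis
  proof (cases "z = 0")
    case True
    then have "eigen k 1 = 0" using eigen \<alpha> by simp
    with True show ?thesis by (simp add: limit_moment_def flip: z_def)
  next
    case False
    with \<open>z \<ge> 0\<close> have z: "z > 0" by simp
    have "Gamma (z + 1) = z * Gamma z"
      using z by (intro Gamma_plus1) (auto dest: nonpos_Ints_nonpos)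
    moreover have "Gamma z > 0" using z by (rule Gamma_real_pos)
    moreover have "eigen k 1 = z * (1 + \<alpha>) * C k / \<alpha>"
      using eigen \<alpha> by (simp add: field_simps)
    ultimately show ?thesis
      unfolding limit_moment_def shift z_def[symmetric] using z \<alpha> by (simp add: divide_simps)
  qed
qed

lemma limit_moment_growth: "(\<lambda>k. t ^ k * limit_moment k / fact k) \<longlonglongrightarrow> 0"
proof -
  obtain A B where AB: "\<And>k. egf C $ k \<le> A * B ^ k"
    using egf_C_exponential_bound by blast
  let ?c = "\<alpha> / (1 + \<alpha>)"
  define K where "K = \<bar>A\<bar> * ((1 + \<alpha>) * \<bar>Gamma \<sigma>\<bar> / \<alpha>)"
  have "(\<lambda>k. (\<bar>B\<bar> * \<bar>t\<bar>) ^ k / Gamma (real k * \<beta> - ?c)) \<longlonglongrightarrow> 0"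
    by (rule power_over_Gamma_tendsto_0[OF \<beta>_pos]) simp
  then have lim: "(\<lambda>k. K * \<bar>(\<bar>B\<bar> * \<bar>t\<bar>) ^ k / Gamma (real k * \<beta> - ?c)\<bar>) \<longlonglongrightarrow> 0"
    by (intro tendsto_mult_right_zero tendsto_rabs_zero)
  have "eventually (\<lambda>k. norm (t ^ k * limit_moment k / fact k) \<le>
      K * \<bar>(\<bar>B\<bar> * \<bar>t\<bar>) ^ k / Gamma (real k * \<beta> - ?c)\<bar>) sequentially"
    using eventually_ge_at_top[of 1]
  proof eventually_elim
    case (elim k)
    have z: "(real k * p + \<alpha> * (real k - 1)) / (\<alpha> + 1) = real k * \<beta> - ?c"
      by (simp add: field_simps flip: diff_divide_distrib add.commute[of 1])
    have "t ^ k * limit_moment k / fact k = egf C $ k * ((1 + \<alpha>) * Gamma \<sigma> / \<alpha>) * t ^ k / Gamma (real k * \<beta> - ?c)"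
      using elim unfolding limit_moment_eq[OF elim] z egf_nth by (simp add: mult_ac)
    then have "norm (t ^ k * limit_moment k / fact k) =
        egf C $ k * ((1 + \<alpha>) * \<bar>Gamma \<sigma>\<bar> / \<alpha>) * (\<bar>t\<bar> ^ k / \<bar>Gamma (real k * \<beta> - ?c)\<bar>)"
      using \<alpha> egf_C_nonneg[of k] by (simp add: abs_mult power_abs)
    also have "\<dots> \<le> (\<bar>A\<bar> * \<bar>B\<bar> ^ k) * ((1 + \<alpha>) * \<bar>Gamma \<sigma>\<bar> / \<alpha>) * (\<bar>t\<bar> ^ k / \<bar>Gamma (real k * \<beta> - ?c)\<bar>)"
    proof (intro mult_right_mono)
      have "A * B ^ k \<le> \<bar>A * B ^ k\<bar>" by simp
      then show "egf C $ k \<le> \<bar>A\<bar> * \<bar>B\<bar> ^ k"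
        using AB[of k] unfolding abs_mult power_abs by linarith
    qed (use \<alpha> in auto)
    also have "\<dots> = K * \<bar>(\<bar>B\<bar> * \<bar>t\<bar>) ^ k / Gamma (real k * \<beta> - ?c)\<bar>"
      by (simp add: K_def power_mult_distrib abs_mult power_abs)
    finally show ?case .
  qed
  then show ?thesis
    using lim by (rule Lim_null_comparison)
qed

text \<open>
  The method of moments applies to the scaled weight \<open>Y\<close>; the scaled size \<open>X\<close> is so close to it in mean
  that their characteristic functions have the same limit.
\<close>

theorem cluster_chain_limit:
  obtains \<mu> where "real_distribution \<mu>"
    "weak_conv_m (\<lambda>i. distr (measure_pmf (cluster_chain \<alpha> p i)) borel (\<lambda>(m, w). real m / norming i)) \<mu>"
    "\<And>k. integrable \<mu> (\<lambda>x. x ^ k)" "\<And>k. (\<integral>x. x ^ k \<partial>\<mu>) = limit_moment k"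
proof -
  define X where "X i = (\<lambda>(m, w :: real). real m / norming i)" for i
  define Y where "Y i = (\<lambda>(m :: nat, w). p / (p + \<alpha>) * w / norming i)" for i
  define law where "law i f = distr (measure_pmf (cluster_chain \<alpha> p i)) borel f" for i and f :: "nat \<times> real \<Rightarrow> real"
  have law: "real_distribution (law i f)" for i f
    unfolding law_def by (intro prob_space.real_distribution_distr measure_pmf.prob_space_axioms) simp
  have int: "integrable (law i (Y i)) (\<lambda>x. x ^ k)" for i k
    unfolding law_def by (subst integrable_distr_eq) auto
  have lim: "(\<lambda>i. \<integral>x. x ^ k \<partial>law i (Y i)) \<longlonglongrightarrow> limit_moment k" for k
    using scaled_weight_moment_limit[of k]
    by (simp add: law_def integral_distr Y_def case_prod_unfold)
  obtain \<mu> where \<mu>: "real_distribution \<mu>" "\<And>t. (\<lambda>i. char (law i (Y i)) t) \<longlonglongrightarrow> char \<mu> t"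
    "\<And>k. integrable \<mu> (\<lambda>x. x ^ k)" "\<And>k. (\<integral>x. x ^ k \<partial>\<mu>) = limit_moment k"
    by (rule method_of_moments[OF law int lim limit_moment_growth]) blast
  have "(\<lambda>i. char (law i (X i)) t) \<longlonglongrightarrow> char \<mu> t" for t
  proof -
    have "(\<lambda>i. char (law i (X i)) t - char (law i (Y i)) t) \<longlonglongrightarrow> 0"
    proof (rule Lim_null_comparison[OF always_eventually])
      show "\<forall>i. cmod (char (law i (X i)) t - char (law i (Y i)) t) \<le>
          \<bar>t\<bar> * chain_expectation \<alpha> p i (\<lambda>x. \<bar>X i x - Y i x\<bar>)"
        unfolding law_def by (intro allI char_distr_diff_bound finite_set_cluster_chain)
      show "(\<lambda>i. \<bar>t\<bar> * chain_expectation \<alpha> p i (\<lambda>x. \<bar>X i x - Y i x\<bar>)) \<longlonglongrightarrow> 0"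
        using scaled_discrepancy_tendsto_0
        by (intro tendsto_mult_right_zero) (simp add: X_def Y_def case_prod_unfold)
    qed
    from tendsto_add[OF this \<mu>(2)[of t]] show ?thesis by simp
  qed
  then have "weak_conv_m (\<lambda>i. law i (X i)) \<mu>"
    by (rule levy_continuity[OF law \<mu>(1)])
  then show thesis
    using that \<mu> unfolding law_def X_def by blast
qed

end

section \<open>The root cluster under attachment of a vertex\<close>

definition neighbours :: "nat pair_pre_digraph \<Rightarrow> nat rel" where
  "neighbours T = parcs T \<union> (parcs T)\<inverse>"

text \<open>
  The closure \<^const>\<open>rtrancl_on\<close> confines paths to \<open>S\<close> by itself, so that the arcs need not be
  restricted. The relation \<^const>\<open>neighbours\<close> then depends on the tree only.
\<close>

lemma reachable_induced_iff:
  "u \<rightarrow>\<^sup>*\<^bsub>with_proj (mk_symmetric (with_proj T \<restriction> S))\<^esub> v \<longleftrightarrow> (u, v) \<in> rtrancl_on S (neighbours T)"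
proof -
  let ?G = "with_proj (mk_symmetric (with_proj T \<restriction> S))"
  have arcs: "(x, y) \<in> arcs_ends ?G \<longleftrightarrow> (x, y) \<in> neighbours T \<and> x \<in> S \<and> y \<in> S" for x y
    unfolding neighbours_def by (auto simp: mk_symmetric_def arcs_ends_def arc_to_ends_def image_iff)
  have verts: "verts ?G = S"
    by simp
  show ?thesis
    unfolding reachable_def verts
  proof
    assume "(u, v) \<in> rtrancl_on S (arcs_ends ?G)"
    then show "(u, v) \<in> rtrancl_on S (neighbours T)"
    proof (induction rule: rtrancl_on_induct)
      case (step y z)
      then show ?case
        unfolding arcs by (metis rtrancl_on_into_rtrancl_on)
    qed (rule rtrancl_on_refl)
  next
    assume "(u, v) \<in> rtrancl_on S (neighbours T)"
    then show "(u, v) \<in> rtrancl_on S (arcs_ends ?G)"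
    proof (induction rule: rtrancl_on_induct)
      case (step y z)
      then have "(y, z) \<in> arcs_ends ?G"
        unfolding arcs by blast
      with step show ?case
        by (metis rtrancl_on_into_rtrancl_on)
    qed (rule rtrancl_on_refl)
  qed
qed

lemma mono_root_subtree_iff:
  "mono_root_subtree T c S \<longleftrightarrow> root_vertex \<in> S \<and> S \<subseteq> pverts T \<and> (\<forall>u\<in>S. c u = c root_vertex) \<and>
    (\<forall>u\<in>S. (root_vertex, u) \<in> rtrancl_on S (neighbours T))"
proof -
  have "sym (rtrancl_on S (neighbours T))"
    by (rule rtrancl_on_sym) (auto simp: neighbours_def sym_def)
  have reach: "(\<forall>u\<in>S. \<forall>v\<in>S. (u, v) \<in> rtrancl_on S (neighbours T)) \<longleftrightarrow>
      (\<forall>u\<in>S. (root_vertex, u) \<in> rtrancl_on S (neighbours T))" if "root_vertex \<in> S"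
  proof (intro iffI ballI)
    fix u v assume *: "\<forall>u\<in>S. (root_vertex, u) \<in> rtrancl_on S (neighbours T)" "u \<in> S" "v \<in> S"
    then have "(u, root_vertex) \<in> rtrancl_on S (neighbours T)"
      using symD[OF \<open>sym _\<close>] by blast
    moreover have "(root_vertex, v) \<in> rtrancl_on S (neighbours T)"
      using * by blast
    ultimately show "(u, v) \<in> rtrancl_on S (neighbours T)"
      by (rule rtrancl_on_trans)
  qed (use that in blast)
  have connected: "Digraph_Component.connected (with_proj T \<restriction> S) \<longleftrightarrow>
      (\<forall>u\<in>S. (root_vertex, u) \<in> rtrancl_on S (neighbours T))" if "root_vertex \<in> S"
    unfolding Digraph_Component.connected_def strongly_connected_def reachable_induced_iff reach[OF that, symmetric]
    using that by (simp, blast)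
  have colour: "(\<forall>u\<in>S. \<forall>v\<in>S. c u = c v) \<longleftrightarrow> (\<forall>u\<in>S. c u = c root_vertex)" if "root_vertex \<in> S"
    using that by metis
  show ?thesis
    unfolding mono_root_subtree_def
    by (rule conj_cong[OF refl], rule conj_cong[OF refl], rule conj_cong; erule colour connected)
qed

text \<open>
  The vertices are labelled such that \<open>i + 1\<close> is the next new vertex, as yet without arcs. The
  condition on the weights is the number of arcs in disguise, since out-degrees add up to it.
\<close>

definition attachment_tree :: "real \<Rightarrow> nat \<Rightarrow> nat pair_pre_digraph \<Rightarrow> bool" where
  "attachment_tree \<alpha> i T \<longleftrightarrow> pverts T = {..i} \<and> parcs T \<subseteq> {..i} \<times> {..i} \<and>
     (\<Sum>u\<in>pverts T. attach_weight \<alpha> T u) = tree_weight \<alpha> i"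

lemma out_degree_with_proj: "out_degree (with_proj T) u = card {e \<in> parcs T. fst e = u}"
  by (simp add: out_degree_def out_arcs_def)

lemma attach_weight_add_child:
  assumes "attachment_tree \<alpha> i T" "v \<le> i" "u \<le> i"
  shows "attach_weight \<alpha> (add_child T v) u = attach_weight \<alpha> T u + (if u = v then \<alpha> else 0)"
proof -
  have fin: "finite (parcs T)" and new: "new_vertex T = Suc i" "(v, Suc i) \<notin> parcs T"
    using assms finite_subset[of "parcs T" "{..i} \<times> {..i}"]
    by (auto simp: attachment_tree_def new_vertex_def)
  have "{e \<in> parcs (add_child T v). fst e = u} =
      (if u = v then insert (v, Suc i) {e \<in> parcs T. fst e = u} else {e \<in> parcs T. fst e = u})"
    by (auto simp: add_child_def new)
  then show ?thesis
    using fin new by (simp add: attach_weight_def out_degree_with_proj algebra_simps)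
qed

lemma attach_weight_new_vertex:
  assumes "attachment_tree \<alpha> i T" "v \<le> i"
  shows "attach_weight \<alpha> (add_child T v) (Suc i) = 1"
proof -
  have no_arcs: "{e \<in> parcs (add_child T v). fst e = Suc i} = {}"
    using assms by (auto simp: attachment_tree_def add_child_def)
  show ?thesis
    unfolding attach_weight_def out_degree_with_proj no_arcs by simp
qed

lemma sum_attach_weight_add_child:
  assumes "attachment_tree \<alpha> i T" "v \<le> i" "S \<subseteq> {..i}"
  shows "(\<Sum>u\<in>S. attach_weight \<alpha> (add_child T v) u) =
    (\<Sum>u\<in>S. attach_weight \<alpha> T u) + (if v \<in> S then \<alpha> else 0)"
proof -
  have fin: "finite S" using assms(3) by (rule finite_subset) simp
  have "(\<Sum>u\<in>S. attach_weight \<alpha> (add_child T v) u) =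
      (\<Sum>u\<in>S. attach_weight \<alpha> T u + (if u = v then \<alpha> else 0))"
    using assms by (intro sum.cong refl attach_weight_add_child) auto
  then show ?thesis
    using fin by (simp add: sum.distrib)
qed

lemma attachment_tree_add_child:
  assumes "attachment_tree \<alpha> i T" "v \<le> i"
  shows "attachment_tree \<alpha> (Suc i) (add_child T v)"
proof -
  have new: "new_vertex T = Suc i"
    using assms by (simp add: attachment_tree_def new_vertex_def)
  have "(\<Sum>u\<le>Suc i. attach_weight \<alpha> (add_child T v) u) = tree_weight \<alpha> i + \<alpha> + 1"
    using sum_attach_weight_add_child[OF assms, of "{..i}"] attach_weight_new_vertex[OF assms] assms
    by (auto simp: attachment_tree_def)
  moreover have "tree_weight \<alpha> (Suc i) = tree_weight \<alpha> i + \<alpha> + 1"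
    by (simp add: tree_weight_def algebra_simps)
  moreover have "pverts (add_child T v) = {..Suc i}" "parcs (add_child T v) \<subseteq> {..Suc i} \<times> {..Suc i}"
    using assms new by (auto simp: attachment_tree_def add_child_def)
  ultimately show ?thesis
    by (simp only: attachment_tree_def simp_thms)
qed

text \<open>
  The new vertex is a leaf with neighbour \<open>v\<close>. A path from the root that visits it has to return to \<open>v\<close>
  at once, so deleting the leaf keeps the rest connected, and a set that contains the leaf and
  is connected to the root contains \<open>v\<close>.
\<close>

lemma mono_root_subtree_add_child_iff:
  assumes T: "attachment_tree \<alpha> i T" and v: "v \<le> i"
  shows "mono_root_subtree (add_child T v) (c(Suc i := b)) S \<longleftrightarrow>
    mono_root_subtree T c (S - {Suc i}) \<and> (Suc i \<in> S \<longrightarrow> v \<in> S \<and> b = c v)"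
    (is "mono_root_subtree ?T' ?c' S \<longleftrightarrow> _")
proof
  let ?new = "Suc i"
  have verts: "pverts T = {..i}" "pverts ?T' = {..Suc i}"
    using T attachment_tree_add_child[OF T v] by (auto simp: attachment_tree_def)
  have nbr: "neighbours ?T' = neighbours T \<union> {(v, ?new), (?new, v)}"
    using T by (auto simp: neighbours_def add_child_def new_vertex_def attachment_tree_def)
  have old: "x \<noteq> ?new" "y \<noteq> ?new" if "(x, y) \<in> neighbours T" for x y
    using T that by (auto simp: neighbours_def attachment_tree_def)
  {
    assume S: "mono_root_subtree ?T' ?c' S"
    have path: "(u \<noteq> ?new \<longrightarrow> (root_vertex, u) \<in> rtrancl_on (S - {?new}) (neighbours T)) \<and>
        (u = ?new \<longrightarrow> (root_vertex, v) \<in> rtrancl_on (S - {?new}) (neighbours T))"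
      if "(root_vertex, u) \<in> rtrancl_on S (neighbours ?T')" for u
      using that
    proof (induction rule: rtrancl_on_induct)
      case (step y z)
      consider "(y, z) \<in> neighbours T" | "y = v" "z = ?new" | "y = ?new" "z = v"
        using step.hyps(2) unfolding nbr by blast
      then show ?case
      proof cases
        case 1
        with old have "y \<noteq> ?new" "z \<noteq> ?new" by blast+
        with 1 step show ?thesis
          by (blast intro: rtrancl_on_into_rtrancl_on)
      qed (use step.IH v in simp_all)
    qed simp
    have colour: "?c' u = c root_vertex" if "u \<in> S" for u
      using S that unfolding mono_root_subtree_iff by fastforce
    have "mono_root_subtree T c (S - {?new})"
      unfolding mono_root_subtree_iff
    proof (intro conjI ballI)
      show "root_vertex \<in> S - {?new}" "S - {?new} \<subseteq> pverts T"
        using S unfolding mono_root_subtree_iff verts by auto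
      fix u assume u: "u \<in> S - {?new}"
      then show "c u = c root_vertex" using colour[of u] by simp
      show "(root_vertex, u) \<in> rtrancl_on (S - {?new}) (neighbours T)"
        using path[of u] S u unfolding mono_root_subtree_iff by blast
    qed
    moreover have "v \<in> S \<and> b = c v" if "?new \<in> S"
    proof -
      have "v \<in> S - {?new}"
        using path[of ?new] S that
        unfolding mono_root_subtree_iff by (blast dest: in_rtrancl_on_in_F(2))
      then show ?thesis
        using colour[of v] colour[of ?new] that by auto
    qed
    ultimately show "mono_root_subtree T c (S - {?new}) \<and> (?new \<in> S \<longrightarrow> v \<in> S \<and> b = c v)"
      by blast
  }
  {
    assume S: "mono_root_subtree T c (S - {?new}) \<and> (?new \<in> S \<longrightarrow> v \<in> S \<and> b = c v)"
    have reach: "(root_vertex, u) \<in> rtrancl_on S (neighbours ?T')" if "u \<in> S - {?new}" for u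
    proof (rule rtrancl_on_mono)
      show "(root_vertex, u) \<in> rtrancl_on (S - {?new}) (neighbours T)"
        using S that unfolding mono_root_subtree_iff by blast
    qed (auto simp: nbr)
    have "(root_vertex, ?new) \<in> rtrancl_on S (neighbours ?T')" if "?new \<in> S"
    proof (rule rtrancl_on_into_rtrancl_on)
      show "(root_vertex, v) \<in> rtrancl_on S (neighbours ?T')"
        using S that v by (intro reach) simp
    qed (use that in \<open>auto simp: nbr\<close>)
    with reach have "(root_vertex, u) \<in> rtrancl_on S (neighbours ?T')" if "u \<in> S" for u
      using that by blast
    moreover have "?c' u = c root_vertex" if "u \<in> S" for u
    proof -
      have old_colour: "c x = c root_vertex" if "x \<in> S - {?new}" for x
        using S that unfolding mono_root_subtree_iff by blast
      have "b = c root_vertex" if "?new \<in> S"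
        using S that v old_colour[of v] by auto
      with \<open>u \<in> S\<close> old_colour[of u] show ?thesis by auto
    qed
    moreover have "root_vertex \<in> S" "S \<subseteq> pverts ?T'"
      using S unfolding mono_root_subtree_iff verts by auto
    ultimately show "mono_root_subtree ?T' ?c' S"
      unfolding mono_root_subtree_iff by simp
  }
qed

lemma root_cluster_add_child:
  assumes T: "attachment_tree \<alpha> i T" and v: "v \<le> i"
  shows "root_cluster (add_child T v) (c(Suc i := b)) =
    (if v \<in> root_cluster T c \<and> b = c v then insert (Suc i) (root_cluster T c) else root_cluster T c)"
proof -
  let ?R = "root_cluster T c" and ?R' = "root_cluster (add_child T v) (c(Suc i := b))"
  note iff = mono_root_subtree_add_child_iff[OF T v]
  have root: "root_vertex \<in> pverts T" "root_vertex \<in> pverts (add_child T v)"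
    using T by (auto simp: attachment_tree_def add_child_def)
  have R: "mono_root_subtree T c ?R"
    by (rule root_cluster_greatest(1)[OF root(1)])
  then have new: "Suc i \<notin> ?R"
    using T unfolding mono_root_subtree_iff attachment_tree_def by auto
  from iffD1[OF iff root_cluster_greatest(1)[OF root(2)]]
  have R': "mono_root_subtree T c (?R' - {Suc i})" "Suc i \<in> ?R' \<Longrightarrow> v \<in> ?R' \<and> b = c v"
    by blast+
  then have upper: "?R' - {Suc i} \<subseteq> ?R"
    using root_cluster_greatest(2)[OF root(1)] by blast
  have lower: "?R \<subseteq> ?R'"
    using R new by (intro root_cluster_greatest(2)[OF root(2)]) (simp add: iff)
  show ?thesis
  proof (cases "v \<in> ?R \<and> b = c v")
    case True
    then have "insert (Suc i) ?R \<subseteq> ?R'"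
      using R new by (intro root_cluster_greatest(2)[OF root(2)]) (simp add: iff)
    with upper have "?R' = insert (Suc i) ?R"
      by blast
    then show ?thesis by (simp only: True simp_thms if_True)
  next
    case False
    have "Suc i \<notin> ?R'"
    proof
      assume "Suc i \<in> ?R'"
      from R'(2)[OF this] upper v False show False by auto
    qed
    with upper lower have "?R' = ?R"
      by blast
    then show ?thesis by (simp only: False if_False)
  qed
qed

definition cluster_state :: "real \<Rightarrow> coloured_tree \<Rightarrow> nat \<times> real" where
  "cluster_state \<alpha> = (\<lambda>(T, c). (card (root_cluster T c), \<Sum>u\<in>root_cluster T c. attach_weight \<alpha> T u))"

lemma root_cluster_subset:
  assumes "attachment_tree \<alpha> i T"
  shows "root_cluster T c \<subseteq> {..i}"
  using assms by (auto simp: root_cluster_def mono_root_subtree_def attachment_tree_def)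

lemma cluster_state_add_child:
  assumes T: "attachment_tree \<alpha> i T" and v: "v \<le> i" and state: "cluster_state \<alpha> (T, c) = (m, w)"
  shows "cluster_state \<alpha> (add_child T v, c(Suc i := (if same then c v else \<not> c v))) =
    (if v \<in> root_cluster T c then if same then (Suc m, w + (\<alpha> + 1)) else (m, w + \<alpha>) else (m, w))"
proof -
  let ?R = "root_cluster T c"
  have sub: "?R \<subseteq> {..i}" by (rule root_cluster_subset[OF T])
  then have fin: "finite ?R" "Suc i \<notin> ?R"
    using finite_subset[of _ "{..i}"] by auto
  have "m = card ?R" "w = (\<Sum>u\<in>?R. attach_weight \<alpha> T u)"
    using state by (auto simp: cluster_state_def)
  then show ?thesis
    using fin sum_attach_weight_add_child[OF T v sub] attach_weight_new_vertex[OF T v]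
    by (auto simp: cluster_state_def root_cluster_add_child[OF T v])
qed

lemma bool_pmf_eq_bernoulli: "M = bernoulli_pmf (pmf M True)"
proof (rule pmf_eqI)
  fix b
  have "(\<Sum>b\<in>UNIV. pmf M b) = 1"
    by (rule sum_pmf_eq_1) auto
  then have "pmf M True + pmf M False = 1"
    by (simp add: UNIV_bool add.commute)
  then show "pmf M b = pmf (bernoulli_pmf (pmf M True)) b"
    by (cases b) (auto simp: pmf_le_1)
qed

text \<open>
  The only feature of the chosen vertex that matters for the state of the cluster is whether it lies in it,
  and this has probability proportional to the weight of the cluster.
\<close>

lemma attach_to_cluster_pmf:
  assumes \<alpha>: "\<alpha> > 0" and T: "attachment_tree \<alpha> i T" and S: "S \<subseteq> {..i}"
  shows "map_pmf (\<lambda>v. v \<in> S) (attach_pmf \<alpha> T) =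
    bernoulli_pmf ((\<Sum>u\<in>S. attach_weight \<alpha> T u) / tree_weight \<alpha> i)"
proof -
  have T': "finite (pverts T)" "pverts T \<noteq> {}" "pverts T = {..i}" "sum (attach_weight \<alpha> T) (pverts T) = tree_weight \<alpha> i"
    using T by (auto simp: attachment_tree_def)
  have fin: "finite S" using S by (rule finite_subset) simp
  have "pmf (map_pmf (\<lambda>v. v \<in> S) (attach_pmf \<alpha> T)) True = measure (measure_pmf (attach_pmf \<alpha> T)) S"
    by (simp add: pmf_map vimage_def)
  also have "\<dots> = (\<Sum>v\<in>S. pmf (attach_pmf \<alpha> T) v)"
    by (rule measure_measure_pmf_finite[OF fin])
  also have "\<dots> = (\<Sum>v\<in>S. attach_weight \<alpha> T v / tree_weight \<alpha> i)"
    using S \<alpha> T' by (intro sum.cong refl) (auto simp: pmf_attach_pmf)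
  finally have "pmf (map_pmf (\<lambda>v. v \<in> S) (attach_pmf \<alpha> T)) True = (\<Sum>v\<in>S. attach_weight \<alpha> T v) / tree_weight \<alpha> i"
    by (simp add: sum_divide_distrib)
  then show ?thesis
    using bool_pmf_eq_bernoulli by metis
qed

lemma set_pmf_attach_pmf:
  assumes "\<alpha> > 0" "attachment_tree \<alpha> i T"
  shows "set_pmf (attach_pmf \<alpha> T) \<subseteq> {..i}"
proof
  fix v assume "v \<in> set_pmf (attach_pmf \<alpha> T)"
  then have "pmf (attach_pmf \<alpha> T) v \<noteq> 0" by (simp add: set_pmf_iff)
  then show "v \<in> {..i}"
    using assms pmf_attach_pmf[of \<alpha> T v] by (auto simp: attachment_tree_def split: if_splits)
qed

lemma map_cluster_state_step:
  assumes \<alpha>: "\<alpha> > 0" and T: "attachment_tree \<alpha> i T"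
  shows "map_pmf (cluster_state \<alpha>) (coloured_tree_step \<alpha> p (T, c)) =
    cluster_step \<alpha> p i (cluster_state \<alpha> (T, c))"
proof -
  obtain m w where state: "cluster_state \<alpha> (T, c) = (m, w)" by (cases "cluster_state \<alpha> (T, c)")
  have w: "w = (\<Sum>u\<in>root_cluster T c. attach_weight \<alpha> T u)"
    using state by (simp add: cluster_state_def)
  have new: "new_vertex T = Suc i"
    using T by (simp add: attachment_tree_def new_vertex_def)
  let ?F = "\<lambda>hit same. if hit then if same then (Suc m, w + (\<alpha> + 1)) else (m, w + \<alpha>) else (m, w)"
  have "map_pmf (cluster_state \<alpha>) (coloured_tree_step \<alpha> p (T, c)) =
    attach_pmf \<alpha> T \<bind> (\<lambda>v. bernoulli_pmf p \<bind> (\<lambda>same. return_pmf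
      (cluster_state \<alpha> (add_child T v, c(Suc i := (if same then c v else \<not> c v))))))"
    by (simp add: coloured_tree_step_def map_bind_pmf new)
  also have "\<dots> = attach_pmf \<alpha> T \<bind> (\<lambda>v. bernoulli_pmf p \<bind> (\<lambda>same. return_pmf
      (?F (v \<in> root_cluster T c) same)))"
  proof (intro bind_pmf_cong refl)
    fix v same assume "v \<in> set_pmf (attach_pmf \<alpha> T)"
    then have "v \<le> i" using set_pmf_attach_pmf[OF \<alpha> T] by auto
    then show "return_pmf (cluster_state \<alpha> (add_child T v, c(Suc i := (if same then c v else \<not> c v)))) =
        return_pmf (?F (v \<in> root_cluster T c) same)"
      by (simp only: cluster_state_add_child[OF T _ state])
  qed
  also have "\<dots> = map_pmf (\<lambda>v. v \<in> root_cluster T c) (attach_pmf \<alpha> T) \<bind>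
      (\<lambda>hit. bernoulli_pmf p \<bind> (\<lambda>same. return_pmf (?F hit same)))"
    by (simp add: bind_map_pmf)
  also have "\<dots> = cluster_step \<alpha> p i (m, w)"
    by (simp add: attach_to_cluster_pmf[OF \<alpha> T root_cluster_subset[OF T]] cluster_step_def flip: w)
  finally show ?thesis
    by (simp add: state)
qed

lemma attachment_tree_coloured_tree_pmf:
  assumes \<alpha>: "\<alpha> > 0" and "(T, c) \<in> set_pmf (coloured_tree_pmf \<alpha> p (Suc i))"
  shows "attachment_tree \<alpha> i T"
  using assms(2)
proof (induction i arbitrary: T c)
  case 0
  then show ?case
    by (auto simp: attachment_tree_def single_vertex_def attach_weight_def out_degree_with_proj tree_weight_def)
next
  case (Suc i)
  then obtain T' c' v where T': "(T', c') \<in> set_pmf (coloured_tree_pmf \<alpha> p (Suc i))"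
    and v: "v \<in> set_pmf (attach_pmf \<alpha> T')" "T = add_child T' v"
    by (auto simp: coloured_tree_step_def set_bind_pmf simp del: coloured_tree_pmf.simps(2)
      simp add: coloured_tree_pmf.simps(2)[of _ _ "Suc i"])
  have "attachment_tree \<alpha> i T'" by (rule Suc.IH[OF T'])
  then show ?case
    using v set_pmf_attach_pmf[OF \<alpha>] by (auto intro: attachment_tree_add_child)
qed

text \<open>
  The lumping of the growing coloured tree into the chain: the law of the next state is a function of the
  present state of the cluster, whatever the rest of the tree looks like.
\<close>

theorem map_cluster_state_coloured_tree_pmf:
  assumes \<alpha>: "\<alpha> > 0"
  shows "map_pmf (cluster_state \<alpha>) (coloured_tree_pmf \<alpha> p (Suc i)) = cluster_chain \<alpha> p i"
proof (induction i)
  case 0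
  have "cluster_state \<alpha> (single_vertex, \<lambda>_. b) = (1, 1)" for b
  proof -
    have "mono_root_subtree single_vertex (\<lambda>_. b) {root_vertex}"
      by (auto simp: mono_root_subtree_iff single_vertex_def)
    then have "root_cluster single_vertex (\<lambda>_. b) = {root_vertex}"
      by (auto simp: root_cluster_def mono_root_subtree_def single_vertex_def)
    then show ?thesis
      by (simp add: cluster_state_def attach_weight_def out_degree_with_proj single_vertex_def)
  qed
  then show ?case
    by (simp add: pmf.map_comp o_def)
next
  case (Suc i)
  have "map_pmf (cluster_state \<alpha>) (coloured_tree_pmf \<alpha> p (Suc (Suc i))) =
    coloured_tree_pmf \<alpha> p (Suc i) \<bind> (\<lambda>x. map_pmf (cluster_state \<alpha>) (coloured_tree_step \<alpha> p x))"
    unfolding coloured_tree_pmf.simps(2)[of _ _ "Suc i"] by (simp add: map_bind_pmf)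
  also have "\<dots> = coloured_tree_pmf \<alpha> p (Suc i) \<bind> (\<lambda>x. cluster_step \<alpha> p i (cluster_state \<alpha> x))"
  proof (intro bind_pmf_cong refl)
    fix x assume x: "x \<in> set_pmf (coloured_tree_pmf \<alpha> p (Suc i))"
    show "map_pmf (cluster_state \<alpha>) (coloured_tree_step \<alpha> p x) = cluster_step \<alpha> p i (cluster_state \<alpha> x)"
      using attachment_tree_coloured_tree_pmf[OF \<alpha>, of "fst x" "snd x" p i] x
        map_cluster_state_step[OF \<alpha>, of i "fst x" p "snd x"] by simp
  qed
  also have "\<dots> = map_pmf (cluster_state \<alpha>) (coloured_tree_pmf \<alpha> p (Suc i)) \<bind> cluster_step \<alpha> p i"
    by (simp add: bind_map_pmf del: coloured_tree_pmf.simps)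
  finally show ?case
    by (simp add: Suc.IH del: coloured_tree_pmf.simps)
qed

theorem theorem2p10:
  fixes \<alpha> p :: real and C :: "nat \<Rightarrow> real"
  assumes "\<alpha> > 0" and "0 \<le> p" and "p \<le> 1"
    and "C 1 = \<alpha> / (p + \<alpha>)"
    and "\<And>k. k \<ge> 2 \<Longrightarrow>
      (real k - 1) * (p / \<alpha> + 1) * C k =
        (\<Sum>j=2..k. p ^ j * Gamma (1 / \<alpha> + real j) / Gamma (1 / \<alpha>) * partial_bell k j C)"
  shows "\<exists>\<mu>. real_distribution \<mu> \<and>
    weak_conv_m
      (\<lambda>n. distr (measure_pmf (coloured_tree_pmf \<alpha> p n)) borel
        (\<lambda>(T, c). real (card (root_cluster T c)) / real n powr ((p + \<alpha>) / (1 + \<alpha>)))) \<mu> \<and>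
    (\<forall>k\<ge>1. integrable \<mu> (\<lambda>x. x ^ k) \<and>
      (\<integral>x. x ^ k \<partial>\<mu>) =
        C k * (1 + \<alpha>) * Gamma (1 / (1 + \<alpha>)) /
          (\<alpha> * Gamma ((real k * p + \<alpha> * (real k - 1)) / (\<alpha> + 1))))"
proof -
  interpret cluster_moments \<alpha> p C
    using assms by unfold_locales
  let ?law = "\<lambda>n. distr (measure_pmf (coloured_tree_pmf \<alpha> p n)) borel
        (\<lambda>(T, c). real (card (root_cluster T c)) / real n powr ((p + \<alpha>) / (1 + \<alpha>)))"
  obtain \<mu> where \<mu>: "real_distribution \<mu>"
    "weak_conv_m (\<lambda>i. distr (measure_pmf (cluster_chain \<alpha> p i)) borel (\<lambda>(m, w). real m / norming i)) \<mu>"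
    "\<And>k. integrable \<mu> (\<lambda>x. x ^ k)" "\<And>k. (\<integral>x. x ^ k \<partial>\<mu>) = limit_moment k"
    by (rule cluster_chain_limit) blast
  have "distr (measure_pmf (cluster_chain \<alpha> p i)) borel (\<lambda>(m, w). real m / norming i) = ?law (Suc i)" for i
    unfolding map_cluster_state_coloured_tree_pmf[OF assms(1), symmetric] map_pmf_rep_eq
    by (subst distr_distr) (auto simp: o_def cluster_state_def norming_def case_prod_unfold)
  then have "weak_conv_m (\<lambda>i. ?law (Suc i)) \<mu>"
    using \<mu>(2) by simp
  then have weak: "(\<lambda>i. cdf (?law (Suc i)) x) \<longlonglongrightarrow> cdf \<mu> x" if "isCont (cdf \<mu>) x" for x
    using that unfolding weak_conv_m_def weak_conv_def by blast
  have "(\<lambda>n. cdf (?law n) x) \<longlonglongrightarrow> cdf \<mu> x" if "isCont (cdf \<mu>) x" for x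
    using weak[OF that] by (rule LIMSEQ_imp_Suc)
  then have "weak_conv_m ?law \<mu>"
    unfolding weak_conv_m_def weak_conv_def by blast
  then show ?thesis
    using \<mu>(1,3) by (intro exI[of _ \<mu>] conjI allI impI) (simp_all only: \<mu>(4) limit_moment_eq)
qed

end
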